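(* Let $f\colon\mathbb{R}_+\to\mathbb{R}_+$ be continuous and nondecreasing, and assume that for some numbers $a\in(0,1)$, $R_0$ and $R_1$ with $0<R_0<R_1$, one has $$\frac{f(M_0(a)R_0)}{M_0(a)R_0}\ge\frac{1}{(1-a)M_0(a)^2},\qquad \frac{f\left(\frac23R_1\right)}{R_1}\le\frac{15}{4}.$$ Let $m=\inf_{u\in K_{R_0R_1}}E(u)$. Then the boundary value problem $$u^{(4)}(t)-f(u(t))=0\ \ (0<t<1),\qquad u(0)=u'(0)=u''(1)=u'''(1)=0 \tag{P}$$ has at least one positive solution $u_m\in K_{R_0R_1}$ with $E(u_m)=m$. If, in addition, there exist $u_0,u_1\in K_{R_0R_1}$ and $r>0$ such that $|u_0|<r<|u_1|$ and $$\max\{E(u_0),E(u_1)\}<\inf\{E(u): u\in K,\ |u|=r\},$$ then (P) has a second positive solution $u_c\in K_{R_0R_1}$ with $E(u_c)=c$, where $$c=\inf_{\gamma\in\Gamma}\max_{t\in[0,1]}E(\gamma(t)),\qquad \Gamma=\{\gamma\in C([0,1];K_{R_0R_1}):\gamma(0)=u_0,\ \gamma(1)=u_1\}.$$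
   Context: $\mathbb{R}_+=[0,\infty)$. $X=\{u\in H^2(0,1): u(0)=u'(0)=0\}$ is the Hilbert space with inner product $(u,v)=\int_0^1u''v''\,dt$ and norm $|u|=\bigl(\int_0^1 u''(t)^2dt\bigr)^{1/2}$. For $t\in[0,1]$, $M_0(t)=\frac{\sqrt2\,(1-t)t^3}{6}$. The cone is $K=\{u\in X: u\text{ is convex and }u(t)\ge M_0(t)|u|\text{ for all }t\in[0,1]\}$ (its elements are nonnegative functions), and the conical shell is $K_{R_0R_1}=\{u\in K: R_0\le|u|\le R_1\}$. Continuity of paths $\gamma$ is with respect to the norm $|\cdot|$ of $X$. The energy functional is $E(u)=\frac12|u|^2-\int_0^1F(u(t))\,dt$ for $u\in K$, where $F(u)=\int_0^uf(s)\,ds$ for $u\ge 0$. A solution of the problem is a classical one ($u\in C^4[0,1]$); it is positive if it is nonnegative on $[0,1]$ and not identically zero. "Second" means distinct from $u_m$. *)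

theory Defs
  imports "HOL-Analysis.Analysis"
begin

text \<open>The Sobolev space \<open>H\<^sup>2(0,1)\<close>, defined through weak derivatives, with
  continuously differentiable test functions whose support is a compact subset of \<open>(0,1)\<close>.\<close>

definition L2 :: "(real \<Rightarrow> real) set" where
  "L2 = {v. v \<in> borel_measurable (lebesgue_on {0<..<1}) \<and>
            integrable (lebesgue_on {0<..<1}) (\<lambda>t. (v t)\<^sup>2)}"

definition test_fun :: "(real \<Rightarrow> real) \<Rightarrow> bool" where
  "test_fun \<phi> \<longleftrightarrow> \<phi> C1_differentiable_on UNIV \<and> closure {t. \<phi> t \<noteq> 0} \<subseteq> {0<..<1}"

definition is_weak_deriv :: "(real \<Rightarrow> real) \<Rightarrow> (real \<Rightarrow> real) \<Rightarrow> bool" where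
  "is_weak_deriv u v \<longleftrightarrow>
     (\<forall>\<phi>. test_fun \<phi> \<longrightarrow>
        (LINT t|lebesgue_on {0<..<1}. u t * deriv \<phi> t) =
        - (LINT t|lebesgue_on {0<..<1}. v t * \<phi> t))"

definition H1 :: "(real \<Rightarrow> real) set" where
  "H1 = {u \<in> L2. \<exists>v\<in>L2. is_weak_deriv u v}"

text \<open>The weak derivative is only determined up to a null set; \<open>weak_deriv u\<close> is some
  representative of it, and is used below only where the choice does not matter.\<close>

definition weak_deriv :: "(real \<Rightarrow> real) \<Rightarrow> real \<Rightarrow> real" where
  "weak_deriv u = (SOME v. v \<in> L2 \<and> is_weak_deriv u v)"

definition H2 :: "(real \<Rightarrow> real) set" where
  "H2 = {u \<in> H1. weak_deriv u \<in> H1}"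

text \<open>A class in \<open>H\<^sup>2(0,1)\<close> is represented by its continuous representative on \<open>[0,1]\<close>,
  which is automatically \<open>C\<^sup>1\<close>, so that the pointwise conditions at \<open>0\<close> make sense.
  A function on \<open>[0,1]\<close> is encoded as a function on the reals that vanishes off \<open>[0,1]\<close>;
  thus equality of elements is equality on \<open>[0,1]\<close>.\<close>

definition X :: "(real \<Rightarrow> real) set" where
  "X = {u \<in> H2. continuous_on {0..1} u \<and> (\<forall>t. t \<notin> {0..1} \<longrightarrow> u t = 0) \<and>
          u 0 = 0 \<and> (u has_real_derivative 0) (at 0 within {0..1})}"

definition X_inner :: "(real \<Rightarrow> real) \<Rightarrow> (real \<Rightarrow> real) \<Rightarrow> real" where
  "X_inner u v =
     (LINT t|lebesgue_on {0<..<1}. weak_deriv (weak_deriv u) t * weak_deriv (weak_deriv v) t)"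

definition X_norm :: "(real \<Rightarrow> real) \<Rightarrow> real" where
  "X_norm u = sqrt (X_inner u u)"

definition M0 :: "real \<Rightarrow> real" where
  "M0 t = sqrt 2 * (1 - t) * t ^ 3 / 6"

definition K_cone :: "(real \<Rightarrow> real) set" where
  "K_cone = {u \<in> X. convex_on {0..1} u \<and> (\<forall>t\<in>{0..1}. u t \<ge> M0 t * X_norm u)}"

definition shell :: "real \<Rightarrow> real \<Rightarrow> (real \<Rightarrow> real) set" where
  "shell R0 R1 = {u \<in> K_cone. R0 \<le> X_norm u \<and> X_norm u \<le> R1}"

text \<open>The nonlinearity \<open>f\<close> is a function on \<open>[0,\<infinity>)\<close>; its values at negative arguments
  are never used. The primitive is only meaningful for \<open>x \<ge> 0\<close>.\<close>

definition primitive :: "(real \<Rightarrow> real) \<Rightarrow> real \<Rightarrow> real" where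
  "primitive f x = (LINT s|lebesgue_on {0..x}. f s)"

definition energy :: "(real \<Rightarrow> real) \<Rightarrow> (real \<Rightarrow> real) \<Rightarrow> real" where
  "energy f u = 1/2 * (X_norm u)\<^sup>2 - (LINT t|lebesgue_on {0..1}. primitive f (u t))"

text \<open>Classical solutions, of class \<open>C\<^sup>4[0,1]\<close>; derivatives at the end points are one-sided.\<close>

definition is_solution :: "(real \<Rightarrow> real) \<Rightarrow> (real \<Rightarrow> real) \<Rightarrow> bool" where
  "is_solution f u \<longleftrightarrow>
     (\<exists>u1 u2 u3 u4.
        (\<forall>t\<in>{0..1}.
           (u has_real_derivative u1 t) (at t within {0..1}) \<and>
           (u1 has_real_derivative u2 t) (at t within {0..1}) \<and>
           (u2 has_real_derivative u3 t) (at t within {0..1}) \<and>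
           (u3 has_real_derivative u4 t) (at t within {0..1})) \<and>
        continuous_on {0..1} u4 \<and>
        (\<forall>t\<in>{0<..<1}. u4 t - f (u t) = 0) \<and>
        u 0 = 0 \<and> u1 0 = 0 \<and> u2 1 = 0 \<and> u3 1 = 0)"

definition positive_solution :: "(real \<Rightarrow> real) \<Rightarrow> (real \<Rightarrow> real) \<Rightarrow> bool" where
  "positive_solution f u \<longleftrightarrow>
     is_solution f u \<and> (\<forall>t\<in>{0..1}. u t \<ge> 0) \<and> (\<exists>t\<in>{0..1}. u t \<noteq> 0)"

definition shell_paths ::
    "real \<Rightarrow> real \<Rightarrow> (real \<Rightarrow> real) \<Rightarrow> (real \<Rightarrow> real) \<Rightarrow> (real \<Rightarrow> real \<Rightarrow> real) set" where
  "shell_paths R0 R1 u0 u1 =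
     {\<gamma>. (\<forall>t\<in>{0..1}. \<gamma> t \<in> shell R0 R1) \<and>
         (\<forall>t\<in>{0..1}. ((\<lambda>s. X_norm (\<lambda>x. \<gamma> s x - \<gamma> t x)) \<longlongrightarrow> 0) (at t within {0..1})) \<and>
         \<gamma> 0 = u0 \<and> \<gamma> 1 = u1}"

text \<open>The maximum of the energy along a path is written as a supremum; it is attained,
  since the energy is continuous along paths.\<close>

definition minimax_level ::
    "(real \<Rightarrow> real) \<Rightarrow> real \<Rightarrow> real \<Rightarrow> (real \<Rightarrow> real) \<Rightarrow> (real \<Rightarrow> real) \<Rightarrow> real" where
  "minimax_level f R0 R1 u0 u1 =
     (INF \<gamma>\<in>shell_paths R0 R1 u0 u1. SUP t\<in>{0..1}. energy f (\<gamma> t))"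

end

theory Submission
  imports Defs "HOL-Complex_Analysis.Great_Picard" "HOL-Real_Asymp.Real_Asymp"
begin

text \<open>Let \<open>N u\<close> be the solution \<open>w\<close> of \<open>w'''' = f(u)\<close> under the four boundary conditions. Then
  \<open>(N u, v) = \<integral> f(u) v\<close>, so the energy has gradient \<open>u - N u\<close> and solutions of the problem are fixed
  points of \<open>N\<close>. Three facts replace the usual deformation by a flow. First, the shell contains the
  whole segment from \<open>u\<close> to \<open>N u\<close>: \<open>N\<close> maps the cone into itself, the bound on \<open>f(2/3 R1)\<close> gives
  \<open>|N u| \<le> R1\<close>, and the bound on \<open>f(M0 a R0)\<close> gives \<open>(N u, u) \<ge> R0 |u|\<close>. Secondly, \<open>f\<close> is nondecreasing,
  so its primitive is convex, whence \<open>E (u + s (N u - u)) \<le> E u - s/2 |N u - u|\<^sup>2\<close> for \<open>0 \<le> s \<le> 1\<close>.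
  Thirdly, \<open>N\<close> is compact by Arzela-Ascoli, so almost fixed points accumulate at fixed points. A single
  step towards \<open>N u\<close>, with a length depending continuously on \<open>E u\<close> that vanishes at the levels of the
  end points, therefore already serves as the deformation of paths.\<close>

section \<open>Minimization and mountain pass for a descent map\<close>

text \<open>The shell is not convex, so segments are kept off the ball of radius \<open>R0\<close>
  by pairing with \<open>u\<close>: every \<open>w\<close> between \<open>u\<close> and
  \<open>N u\<close> satisfies \<open>inner w u >= R0 * norm u\<close>, and Cauchy-Schwarz gives
  \<open>norm w >= R0\<close>. The constants come from pointwise bounds. Writing
  \<open>u'(t)\<close> as a pairing with an element of norm \<open>sqrt t\<close> gives
  \<open>|u(t)| <= 2/3 t^(3/2) |u|\<close>; the value at \<open>t = 1\<close> explains the argument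
  \<open>2/3 R1\<close>, and the integral over [0,1] has the factor 4/15, the reciprocal of 15/4.
  The quantity \<open>(1 - a) M0(a)^2\<close> arises from integrating \<open>f(u) u\<close> over
  [a,1] alone, where \<open>u >= M0(a) |u|\<close>. Monotonicity of \<open>f\<close> enters a second
  time: with \<open>u\<close> nondecreasing it makes \<open>f(u)\<close> nondecreasing, which puts
  \<open>N u\<close> into the cone. Because the norm of \<open>X\<close> is built from chosen
  representatives of weak derivatives, elements of \<open>X\<close> are identified with double
  primitives of square integrable functions before any estimate is made. The second solution differs
  from the minimizer because its level \<open>c\<close> lies strictly above
  \<open>E(u0)\<close>.\<close>

definition paths_in :: "'a::topological_space set \<Rightarrow> 'a \<Rightarrow> 'a \<Rightarrow> (real \<Rightarrow> 'a) set" where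
  "paths_in S u0 u1 = {\<gamma>. continuous_on {0..1} \<gamma> \<and> \<gamma> ` {0..1} \<subseteq> S \<and> \<gamma> 0 = u0 \<and> \<gamma> 1 = u1}"

locale descent_map =
  fixes S :: "'a::real_normed_vector set" and E :: "'a \<Rightarrow> real" and N :: "'a \<Rightarrow> 'a"
  assumes closed_S: "closed S"
    and cont_E: "continuous_on S E"
    and cont_N: "continuous_on S N"
    and segment: "\<lbrakk>u \<in> S; 0 \<le> s; s \<le> 1\<rbrakk> \<Longrightarrow> u + s *\<^sub>R (N u - u) \<in> S"
    and descent: "\<lbrakk>u \<in> S; 0 \<le> s; s \<le> 1\<rbrakk> \<Longrightarrow> E (u + s *\<^sub>R (N u - u)) \<le> E u - s / 2 * (norm (N u - u))\<^sup>2"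
    and seq_compact_N: "(\<And>n. x n \<in> S) \<Longrightarrow> \<exists>w r. strict_mono (r :: nat \<Rightarrow> nat) \<and> (\<lambda>n. N (x (r n))) \<longlonglongrightarrow> w"
    and bdd_E: "bdd_below (E ` S)"
begin

text \<open>Compactness is available only for the images \<open>N (u n)\<close>; the vanishing
  residual transfers it to \<open>u n\<close> itself, after which closedness and continuity identify
  the limit.\<close>

lemma fixpoint_of_Palais_Smale:
  assumes S: "\<And>n. u n \<in> S" and E: "(\<lambda>n. E (u n)) \<longlonglongrightarrow> c"
    and PS: "(\<lambda>n. N (u n) - u n) \<longlonglongrightarrow> 0"
  obtains w where "w \<in> S" "N w = w" "E w = c"
proof -
  obtain w r where r: "strict_mono (r :: nat \<Rightarrow> nat)" and w: "(\<lambda>n. N (u (r n))) \<longlonglongrightarrow> w"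
    using seq_compact_N[of u] S by blast
  have "(\<lambda>n. N (u (r n)) - u (r n)) \<longlonglongrightarrow> 0"
    using LIMSEQ_subseq_LIMSEQ[OF PS r] by (simp add: o_def)
  from tendsto_diff[OF w this] have ur: "(\<lambda>n. u (r n)) \<longlonglongrightarrow> w"
    by simp
  have wS: "w \<in> S"
    using closed_sequentially[OF closed_S _ ur] S by blast
  have "(\<lambda>n. N (u (r n))) \<longlonglongrightarrow> N w"
    using continuous_on_tendsto_compose[OF cont_N ur wS] S by simp
  then have "N w = w"
    using w LIMSEQ_unique by blast
  moreover have "(\<lambda>n. E (u (r n))) \<longlonglongrightarrow> E w"
    using continuous_on_tendsto_compose[OF cont_E ur wS] S by simp
  then have "E w = c"
    using LIMSEQ_subseq_LIMSEQ[OF E r] LIMSEQ_unique by (fastforce simp: o_def)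
  ultimately show thesis using that wS by blast
qed

text \<open>The residual is measured by its square because that is what \<open>descent\<close>
  controls; a square root is taken once the tolerance \<open>1/(n+1)\<close> has been sent to
  zero.\<close>

lemma fixpoint_at_level:
  assumes "\<And>\<epsilon>. \<epsilon> > 0 \<Longrightarrow> \<exists>u\<in>S. \<bar>E u - c\<bar> \<le> \<epsilon> \<and> (norm (N u - u))\<^sup>2 \<le> \<epsilon>"
  obtains w where "w \<in> S" "N w = w" "E w = c"
proof -
  have "\<exists>u. \<forall>n. u n \<in> S \<and> \<bar>E (u n) - c\<bar> \<le> inverse (real (Suc n)) \<and>
      (norm (N (u n) - u n))\<^sup>2 \<le> inverse (real (Suc n))"
    using assms by (intro choice allI) (metis inverse_positive_iff_positive of_nat_0_less_iff zero_less_Suc)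
  then obtain u where u: "\<And>n. u n \<in> S" "\<And>n. \<bar>E (u n) - c\<bar> \<le> inverse (real (Suc n))"
    "\<And>n. (norm (N (u n) - u n))\<^sup>2 \<le> inverse (real (Suc n))" by blast
  have "(\<lambda>n. E (u n) - c) \<longlonglongrightarrow> 0"
    by (rule tendsto_rabs_zero_cancel, rule tendsto_sandwich[OF _ _ tendsto_const LIMSEQ_inverse_real_of_nat])
      (use u in auto)
  then have E: "(\<lambda>n. E (u n)) \<longlonglongrightarrow> c"
    by (simp add: LIM_zero_iff)
  have "(\<lambda>n. (norm (N (u n) - u n))\<^sup>2) \<longlonglongrightarrow> 0"
    by (rule tendsto_sandwich[OF _ _ tendsto_const LIMSEQ_inverse_real_of_nat])
      (use u in auto)
  then have "(\<lambda>n. sqrt ((norm (N (u n) - u n))\<^sup>2)) \<longlonglongrightarrow> sqrt 0"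
    by (rule tendsto_real_sqrt)
  then have "(\<lambda>n. N (u n) - u n) \<longlonglongrightarrow> 0"
    by (simp add: tendsto_norm_zero_iff)
  from fixpoint_of_Palais_Smale[OF u(1) E this] that show thesis by blast
qed

text \<open>A full step to \<open>N u\<close> lowers \<open>E\<close> by half the squared residual
  and cannot go below the infimum, so a point within \<open>\<epsilon> / 2\<close> of the infimum
  has squared residual at most \<open>\<epsilon>\<close>.\<close>

lemma minimum_at_fixpoint:
  assumes "S \<noteq> {}"
  obtains w where "w \<in> S" "N w = w" "E w = (INF u\<in>S. E u)"
proof (rule fixpoint_at_level)
  fix \<epsilon> :: real assume "\<epsilon> > 0"
  then have "(INF u\<in>S. E u) < (INF u\<in>S. E u) + \<epsilon> / 2" by simp
  then obtain u where u: "u \<in> S" "E u < (INF u\<in>S. E u) + \<epsilon> / 2"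
    using cInf_lessD[of "E ` S"] assms by fastforce
  have "(INF u\<in>S. E u) \<le> E (N u)"
    using segment[OF u(1), of 1] by (intro cINF_lower[OF bdd_E]) simp
  also have "\<dots> \<le> E u - 1 / 2 * (norm (N u - u))\<^sup>2"
    using descent[OF u(1), of 1] by simp
  finally have "(norm (N u - u))\<^sup>2 \<le> \<epsilon>" using u(2) by linarith
  moreover have "(INF u\<in>S. E u) \<le> E u"
    by (rule cINF_lower[OF bdd_E u(1)])
  ultimately show "\<exists>u\<in>S. \<bar>E u - (INF u\<in>S. E u)\<bar> \<le> \<epsilon> \<and> (norm (N u - u))\<^sup>2 \<le> \<epsilon>"
    using u \<open>\<epsilon> > 0\<close> by (intro bexI[of _ u]) auto
qed (use that in blast)

lemma bdd_above_path:
  assumes "\<gamma> \<in> paths_in S u0 u1" shows "bdd_above ((\<lambda>t. E (\<gamma> t)) ` {0..1})"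
proof -
  have "continuous_on {0..1} (\<lambda>t. E (\<gamma> t))"
    using assms cont_E unfolding paths_in_def
    by (auto intro!: continuous_on_compose2[OF cont_E])
  then show ?thesis
    by (intro bounded_imp_bdd_above compact_imp_bounded compact_continuous_image) auto
qed

lemma mountain_pass:
  fixes u0 u1 :: 'a
  defines "c \<equiv> INF \<gamma>\<in>paths_in S u0 u1. SUP t\<in>{0..1}. E (\<gamma> t)"
  assumes ne: "paths_in S u0 u1 \<noteq> {}" and c: "E u0 < c" "E u1 < c"
  obtains w where "w \<in> S" "N w = w" "E w = c"
proof (rule fixpoint_at_level)
  \<comment> \<open>A real infimum bounds its members only for sets bounded below. Each path
    supremum is at least the value at time 0.\<close>
  have bdd: "bdd_below ((\<lambda>\<gamma>. SUP t\<in>{0..1}. E (\<gamma> t)) ` paths_in S u0 u1)"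
  proof (rule bdd_belowI2)
    fix \<gamma> assume g: "\<gamma> \<in> paths_in S u0 u1"
    then have "E (\<gamma> 0) \<le> (SUP t\<in>{0..1}. E (\<gamma> t))"
      by (intro cSUP_upper bdd_above_path) auto
    then show "E u0 \<le> (SUP t\<in>{0..1}. E (\<gamma> t))"
      using g by (simp add: paths_in_def)
  qed
  fix \<epsilon>' :: real assume \<epsilon>': "\<epsilon>' > 0"
  \<comment> \<open>The second argument of \<open>min\<close> puts both end point levels at or below
    \<open>c - \<epsilon>\<close>, where the step length will vanish, so the deformed path keeps its
    end points.\<close>
  define \<epsilon> where "\<epsilon> = min \<epsilon>' (c - max (E u0) (E u1))"
  have \<epsilon>: "\<epsilon> > 0" "\<epsilon> \<le> \<epsilon>'" "E u0 \<le> c - \<epsilon>" "E u1 \<le> c - \<epsilon>"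
    using c \<epsilon>' by (auto simp: \<epsilon>_def)
  show "\<exists>u\<in>S. \<bar>E u - c\<bar> \<le> \<epsilon>' \<and> (norm (N u - u))\<^sup>2 \<le> \<epsilon>'"
  proof (rule ccontr)
    assume "\<not> ?thesis"
    then have far: "(norm (N u - u))\<^sup>2 \<ge> \<epsilon>" if "u \<in> S" "\<bar>E u - c\<bar> \<le> \<epsilon>" for u
      using that \<epsilon>(2) by force
    \<comment> \<open>Step length as a function of the level: 0 up to \<open>c - \<epsilon>\<close>,
      1 from \<open>c - \<epsilon> / 2\<close> on, linear in between and hence continuous.\<close>
    define \<theta> where "\<theta> e = max 0 (min 1 ((e - (c - \<epsilon>)) / (\<epsilon> / 2)))" for e :: real
    have \<theta>: "0 \<le> \<theta> e" "\<theta> e \<le> 1" for e by (auto simp: \<theta>_def)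
    have \<theta>0: "\<theta> e = 0" if "e \<le> c - \<epsilon>" for e
      using that \<epsilon>(1) by (auto simp: \<theta>_def divide_simps)
    have \<theta>1: "\<theta> e = 1" if "e \<ge> c - \<epsilon> / 2" for e
      using that \<epsilon>(1) by (auto simp: \<theta>_def divide_simps)
    \<comment> \<open>Where the step is full, \<open>E\<close> drops by at least
      \<open>\<epsilon> / 2\<close>, so an overshoot of \<open>\<epsilon> / 8\<close> ends at
      \<open>c - 3 * \<epsilon> / 8\<close>. Points at or below \<open>c - \<epsilon> / 2\<close>
      already satisfy that bound.\<close>
    have "c < c + \<epsilon> / 8" using \<epsilon> by simp
    then obtain \<gamma> where \<gamma>: "\<gamma> \<in> paths_in S u0 u1" "(SUP t\<in>{0..1}. E (\<gamma> t)) < c + \<epsilon> / 8"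
      using cInf_lessD[of "(\<lambda>\<gamma>. SUP t\<in>{0..1}. E (\<gamma> t)) ` paths_in S u0 u1"] ne
      unfolding c_def by fastforce
    have E\<gamma>: "E (\<gamma> t) < c + \<epsilon> / 8" if "t \<in> {0..1}" for t
      using cSUP_upper[OF that bdd_above_path[OF \<gamma>(1)]] \<gamma>(2) by linarith
    have S\<gamma>: "\<gamma> t \<in> S" if "t \<in> {0..1}" for t
      using \<gamma>(1) that by (auto simp: paths_in_def)
    define \<delta> where "\<delta> t = \<gamma> t + \<theta> (E (\<gamma> t)) *\<^sub>R (N (\<gamma> t) - \<gamma> t)" for t
    have cont: "continuous_on {0..1} \<gamma>" and sub: "\<gamma> ` {0..1} \<subseteq> S"
      using \<gamma>(1) by (auto simp: paths_in_def)
    have "continuous_on {0..1} \<delta>"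
      unfolding \<delta>_def \<theta>_def using \<epsilon>(1)
      by (intro continuous_intros cont continuous_on_compose2[OF cont_E cont sub]
          continuous_on_compose2[OF cont_N cont sub]) auto
    moreover have "\<delta> ` {0..1} \<subseteq> S"
      unfolding \<delta>_def using S\<gamma> \<theta> by (auto intro: segment)
    moreover have "\<delta> 0 = u0" "\<delta> 1 = u1"
      using \<gamma>(1) \<epsilon>(3,4) by (auto simp: \<delta>_def paths_in_def \<theta>0)
    ultimately have \<delta>: "\<delta> \<in> paths_in S u0 u1" by (simp add: paths_in_def)
    have "E (\<delta> t) \<le> c - 3 * \<epsilon> / 8" if t: "t \<in> {0..1}" for t
    proof -
      have d: "E (\<delta> t) \<le> E (\<gamma> t) - \<theta> (E (\<gamma> t)) / 2 * (norm (N (\<gamma> t) - \<gamma> t))\<^sup>2"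
        unfolding \<delta>_def by (rule descent[OF S\<gamma>[OF t] \<theta>])
      show ?thesis
      proof (cases "E (\<gamma> t) \<le> c - \<epsilon> / 2")
        case True
        have "0 \<le> \<theta> (E (\<gamma> t)) / 2 * (norm (N (\<gamma> t) - \<gamma> t))\<^sup>2" using \<theta> by simp
        then show ?thesis using True d \<epsilon>(1) by linarith
      next
        case False
        then have "(norm (N (\<gamma> t) - \<gamma> t))\<^sup>2 \<ge> \<epsilon>"
          using E\<gamma>[OF t] \<epsilon>(1) by (intro far S\<gamma> t) auto
        then show ?thesis using d False E\<gamma>[OF t] by (simp add: \<theta>1)
      qed
    qed
    then have "(SUP t\<in>{0..1}. E (\<delta> t)) \<le> c - 3 * \<epsilon> / 8"
      by (intro cSUP_least) auto
    moreover have "c \<le> (SUP t\<in>{0..1}. E (\<delta> t))"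
      unfolding c_def by (rule cINF_lower[OF bdd \<delta>])
    ultimately show False using \<epsilon>(1) by linarith
  qed
qed (use that in blast)

end

section \<open>Weak derivatives on the unit interval\<close>

abbreviation \<mu> :: "real measure" where "\<mu> \<equiv> lebesgue_on {0<..<1}"

lemma finite_measure_mu: "finite_measure \<mu>"
  by (rule finite_measure_lebesgue_on) simp

lemma integral_mu_const [simp]: "(LINT t|\<mu>. c) = (c::real)"
  by (simp add: measure_restrict_space)

lemma integrable_mu_const [simp]: "integrable \<mu> (\<lambda>_. c::real)"
  using finite_measure.integrable_const[OF finite_measure_mu] .

lemma borel_measurable_mu_of_continuous:
  fixes q :: "real \<Rightarrow> real"
  assumes "continuous_on {0..1} q"
  shows "q \<in> borel_measurable \<mu>"
  by (rule continuous_imp_measurable_on_sets_lebesgue) (auto intro: continuous_on_subset[OF assms])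

lemma continuous_on_unit_bounded:
  fixes q :: "real \<Rightarrow> real"
  assumes "continuous_on {0..1} q"
  obtains B where "B > 0" "\<And>t. t \<in> {0..1} \<Longrightarrow> \<bar>q t\<bar> \<le> B"
proof -
  have "bounded (q ` {0..1})"
    by (intro compact_imp_bounded compact_continuous_image assms) simp
  then show thesis using that by (auto simp: bounded_pos)
qed

lemma integrable_mu_mult_continuous:
  fixes q :: "real \<Rightarrow> real"
  assumes q: "continuous_on {0..1} q" and p: "integrable \<mu> p"
  shows "integrable \<mu> (\<lambda>t. q t * p t)"
proof -
  obtain B where B: "B > 0" "\<And>t. t \<in> {0..1} \<Longrightarrow> \<bar>q t\<bar> \<le> B"
    using continuous_on_unit_bounded[OF q] by blast
  show ?thesis
  proof (rule Bochner_Integration.integrable_bound)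
    show "integrable \<mu> (\<lambda>t. B * p t)" using p by simp
    show "(\<lambda>t. q t * p t) \<in> borel_measurable \<mu>"
      using borel_measurable_mu_of_continuous[OF q] p by measurable
    show "AE t in \<mu>. norm (q t * p t) \<le> norm (B * p t)"
      using B by (intro AE_I2) (auto simp: abs_mult intro!: mult_right_mono)
  qed
qed

lemma integrable_mu_of_continuous:
  fixes q :: "real \<Rightarrow> real"
  assumes "continuous_on {0..1} q"
  shows "integrable \<mu> q"
  using integrable_mu_mult_continuous[OF assms integrable_mu_const[of 1]] by simp

text \<open>The end points form a null set. This bridge makes the fundamental theorem of calculus
  for gauge integrals available, while Fubini and dominated convergence stay on the Lebesgue
  side.\<close>

lemma integral_mu_eq:
  fixes p :: "real \<Rightarrow> real"
  assumes "integrable \<mu> p"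
  shows "p integrable_on {0..1}" "(LINT t|\<mu>. p t) = integral {0..1} p"
proof -
  have "(p has_integral (LINT t|\<mu>. p t)) {0<..<1}"
    using has_integral_integral_lebesgue_on[OF assms] by simp
  then have *: "(p has_integral (LINT t|\<mu>. p t)) {0..1}"
    by (simp add: has_integral_Icc_iff_Ioo)
  then show "p integrable_on {0..1}" "(LINT t|\<mu>. p t) = integral {0..1} p"
    by (auto simp: integral_unique)
qed

text \<open>Turns a variable domain of integration into an indicator under a fixed measure, the form
  in which Fubini applies.\<close>

lemma integral_mu_cut:
  fixes p :: "real \<Rightarrow> real"
  assumes p: "integrable \<mu> p" and A: "A \<in> sets borel"
  shows "integrable \<mu> (\<lambda>t. p t * indicator A t)"
    "(LINT t|\<mu>. p t * indicator A t) = integral ({0..1} \<inter> A) p"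
proof -
  have [measurable]: "(\<lambda>t. t) \<in> borel_measurable \<mu>"
    by (rule borel_measurable_mu_of_continuous) simp
  have [measurable]: "(\<lambda>t. indicator A t :: real) \<in> borel_measurable \<mu>"
    using A by measurable
  show i: "integrable \<mu> (\<lambda>t. p t * indicator A t)"
  proof (rule Bochner_Integration.integrable_bound[OF p])
    show "(\<lambda>t. p t * indicator A t) \<in> borel_measurable \<mu>" using p by measurable
    show "AE t in \<mu>. norm (p t * indicator A t) \<le> norm (p t)"
      by (intro AE_I2) (simp add: indicator_def)
  qed
  have "(\<lambda>t. p t * indicator A t) = (\<lambda>t. if t \<in> A then p t else 0)"
    by (auto simp: indicator_def)
  then show "(LINT t|\<mu>. p t * indicator A t) = integral ({0..1} \<inter> A) p"
    unfolding integral_mu_eq(2)[OF i]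
    by (simp add: Henstock_Kurzweil_Integration.integral_restrict_Int Int_commute)
qed

text \<open>Fubini on the triangle \<open>s \<le> t\<close>. This is integration by parts for a
  merely integrable \<open>p\<close>; no boundary term survives, since one primitive vanishes at 0
  and the other at 1.\<close>

lemma integral_mu_triangle:
  fixes p q :: "real \<Rightarrow> real"
  assumes p: "integrable \<mu> p" and q: "continuous_on {0..1} q"
  shows "(LINT t|\<mu>. q t * integral {0..t} p) = (LINT s|\<mu>. p s * integral {s..1} q)"
proof -
  interpret finite_measure \<mu> by (rule finite_measure_mu)
  interpret pair_sigma_finite \<mu> \<mu> ..
  have [measurable]: "(\<lambda>t. t) \<in> borel_measurable \<mu>"
    by (rule borel_measurable_mu_of_continuous) simp
  have [measurable]: "q \<in> borel_measurable \<mu>" "p \<in> borel_measurable \<mu>"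
    using borel_measurable_mu_of_continuous[OF q] p by auto
  have qi: "integrable \<mu> q" by (rule integrable_mu_of_continuous[OF q])
  have "integrable (\<mu> \<Otimes>\<^sub>M \<mu>) (\<lambda>(t, s). q t * p s)"
  proof (rule Fubini_integrable)
    show "integrable \<mu> (\<lambda>x. LINT y|\<mu>. norm (case (x, y) of (t, s) \<Rightarrow> q t * p s))"
      using qi by (simp add: abs_mult)
  qed (use p in auto)
  then have int: "integrable (\<mu> \<Otimes>\<^sub>M \<mu>) (\<lambda>(t, s). q t * p s * indicator {..t} s)"
    by (rule Bochner_Integration.integrable_bound)
      (auto simp: indicator_def split_beta' cong: measurable_cong)
  have "(LINT t|\<mu>. q t * integral {0..t} p) = (LINT t|\<mu>. LINT s|\<mu>. q t * p s * indicator {..t} s)"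
  proof (rule Bochner_Integration.integral_cong[OF refl])
    fix t assume t: "t \<in> space \<mu>"
    have *: "{0..1} \<inter> {..t} = {0..t}" using t by auto
    show "q t * integral {0..t} p = (LINT s|\<mu>. q t * p s * indicator {..t} s)"
      using integral_mu_cut(2)[OF p, of "{..t}"] unfolding * by (simp add: mult.assoc)
  qed
  also have "\<dots> = (LINT s|\<mu>. LINT t|\<mu>. q t * p s * indicator {..t} s)"
    by (rule Fubini_integral[symmetric]) (use int in simp)
  also have "\<dots> = (LINT s|\<mu>. p s * integral {s..1} q)"
  proof (rule Bochner_Integration.integral_cong[OF refl])
    fix s assume s: "s \<in> space \<mu>"
    have *: "{0..1} \<inter> {s..} = {s..1}" using s by auto
    have "(\<lambda>t. q t * p s * indicator {..t} s) = (\<lambda>t. p s * (q t * indicator {s..} t))"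
      by (auto simp: indicator_def)
    then show "(LINT t|\<mu>. q t * p s * indicator {..t} s) = p s * integral {s..1} q"
      using integral_mu_cut(2)[OF qi, of "{s..}"] unfolding * by simp
  qed
  finally show ?thesis .
qed

lemma L2_integrable:
  assumes "v \<in> L2" shows "integrable \<mu> v"
proof (rule Bochner_Integration.integrable_bound)
  show "integrable \<mu> (\<lambda>t. 1 + (v t)\<^sup>2)" "v \<in> borel_measurable \<mu>"
    using assms by (auto simp: L2_def)
  have "\<bar>x\<bar> \<le> \<bar>1 + x\<^sup>2\<bar>" for x :: real
    using zero_le_power2[of "\<bar>x\<bar> - 1"] by (simp add: power2_diff)
  then show "AE t in \<mu>. norm (v t) \<le> norm (1 + (v t)\<^sup>2)" by simp
qed

lemma L2_mult_integrable:
  assumes "v \<in> L2" "w \<in> L2" shows "integrable \<mu> (\<lambda>t. v t * w t)"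
proof (rule Bochner_Integration.integrable_bound)
  show "integrable \<mu> (\<lambda>t. (v t)\<^sup>2 + (w t)\<^sup>2)" "(\<lambda>t. v t * w t) \<in> borel_measurable \<mu>"
    using assms by (auto simp: L2_def)
  have "\<bar>x * y\<bar> \<le> \<bar>x\<^sup>2 + y\<^sup>2\<bar>" for x y :: real
    using sum_squares_bound[of "\<bar>x\<bar>" "\<bar>y\<bar>"] abs_ge_zero[of "x * y"]
    unfolding abs_mult power2_abs by linarith
  then show "AE t in \<mu>. norm (v t * w t) \<le> norm ((v t)\<^sup>2 + (w t)\<^sup>2)" by simp
qed

lemma L2_lincomb:
  assumes "v \<in> L2" "w \<in> L2" shows "(\<lambda>t. a * v t + b * w t) \<in> L2"
proof -
  have "(\<lambda>t. (a * v t + b * w t)\<^sup>2) = (\<lambda>t. a\<^sup>2 * (v t)\<^sup>2 + b\<^sup>2 * (w t)\<^sup>2 + 2 * a * b * (v t * w t))"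
    by (auto simp: power2_eq_square algebra_simps)
  then show ?thesis
    using assms L2_mult_integrable[OF assms] by (auto simp: L2_def)
qed

lemma L2_of_continuous:
  assumes "continuous_on {0..1} q" shows "q \<in> L2"
  using borel_measurable_mu_of_continuous[OF assms] assms
  by (auto simp: L2_def intro!: integrable_mu_of_continuous continuous_intros)

section \<open>Vanishing of a function whose half-line integrals vanish\<close>

lemma greaterThan_Int_greaterThan: "{a<..} \<inter> {b<..} = {max a b<..}" for a b :: real
  by auto

text \<open>Half-lines are closed under intersection and generate the Borel sets, so a Dynkin
  argument spreads the vanishing to all Borel sets, with \<open>total\<close> serving the complement
  step. A Lebesgue set is an F-sigma set up to a null set, and a density with all integrals zero is
  zero almost everywhere.\<close>

lemma AE_zero_of_half_line_integrals:
  fixes h :: "real \<Rightarrow> real"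
  assumes h: "integrable lebesgue h" and total: "(LINT x|lebesgue. h x) = 0"
    and half: "\<And>a. (LINT x:{a<..}|lebesgue. h x) = 0"
  shows "AE x in lebesgue. h x = 0"
proof -
  have bi: "set_integrable lebesgue A h" if "A \<in> sets lebesgue" for A
    unfolding set_integrable_def using that h by (rule integrable_mult_indicator)
  have borel: "(LINT x:A|lebesgue. h x) = 0" if "A \<in> sets borel" for A
  proof -
    have A: "A \<in> sigma_sets UNIV (range greaterThan)"
      using that by (subst (asm) borel_Ioi) (simp add: sets_measure_of)
    have stable: "Int_stable (range greaterThan :: real set set)"
      by (auto simp: Int_stable_def greaterThan_Int_greaterThan)
    have sub: "range greaterThan \<subseteq> Pow (UNIV :: real set)" by simp
    from stable sub A show ?thesis
    proof (induction rule: sigma_sets_induct_disjoint)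
      case (basic A) then show ?case using half by auto
    next
      case empty show ?case by (simp add: set_lebesgue_integral_def)
    next
      case (compl A)
      then have A: "A \<in> sets borel" by (subst borel_Ioi) (simp add: sets_measure_of)
      have "(LINT x:A|lebesgue. h x) + (LINT x:UNIV - A|lebesgue. h x) = (LINT x:A \<union> (UNIV - A)|lebesgue. h x)"
        using A by (intro set_integral_Un[symmetric] bi) auto
      then show ?case using compl total by (simp add: set_lebesgue_integral_def)
    next
      case (union A)
      then have A: "A i \<in> sets borel" for i
        by (subst borel_Ioi) (auto simp: sets_measure_of)
      have "(LINT x:(\<Union>i. A i)|lebesgue. h x) = (\<Sum>i. (LINT x:(A i)|lebesgue. h x))"
        using A union(1) by (intro lebesgue_integral_countable_add bi) (auto simp: disjoint_family_on_def)
      then show ?case using union by simp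
    qed
  qed
  show ?thesis
  proof (rule density_unique_real[OF h, of "\<lambda>_. 0"])
    fix A :: "real set" assume "A \<in> sets lebesgue"
    then obtain C T where CT: "fsigma C" "T \<in> null_sets lebesgue" "C \<union> T = A" "disjnt C T"
      using lebesgue_set_almost_fsigma by blast
    have C: "C \<in> sets borel" using CT(1) by (auto elim!: fsigma.cases)
    have T: "(LINT x:T|lebesgue. h x) = 0"
      unfolding set_lebesgue_integral_def
      using AE_not_in[OF CT(2)] by (intro integral_eq_zero_AE) (auto elim!: eventually_mono)
    have "(LINT x:A|lebesgue. h x) = (LINT x:C|lebesgue. h x) + (LINT x:T|lebesgue. h x)"
      unfolding CT(3)[symmetric] using CT C
      by (intro set_integral_Un bi) (auto simp: disjnt_def)
    then show "(LINT x:A|lebesgue. h x) = (LINT x:A|lebesgue. 0)"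
      using borel[OF C] T by simp
  qed simp
qed

section \<open>Test functions\<close>

lemma test_funI:
  assumes D: "\<And>x. (\<phi> has_real_derivative D x) (at x)" "continuous_on UNIV D"
    and supp: "0 < \<alpha>" "\<beta> < 1" "\<And>x. x \<notin> {\<alpha>..\<beta>} \<Longrightarrow> \<phi> x = 0"
  shows "test_fun \<phi>"
proof -
  have "\<phi> C1_differentiable_on UNIV"
    using D unfolding C1_differentiable_on_def has_real_derivative_iff_has_vector_derivative by blast
  moreover have "closure {t. \<phi> t \<noteq> 0} \<subseteq> {\<alpha>..\<beta>}"
    using supp(3) by (intro closure_minimal subsetI closed_atLeastAtMost) (metis mem_Collect_eq)
  then have "closure {t. \<phi> t \<noteq> 0} \<subseteq> {0<..<1}" using supp(1,2) by fastforce
  ultimately show ?thesis by (simp add: test_fun_def)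
qed

lemma test_funE:
  assumes "test_fun \<phi>"
  obtains \<alpha> \<beta> where "\<And>x. (\<phi> has_real_derivative deriv \<phi> x) (at x)" "continuous_on UNIV (deriv \<phi>)"
    "0 < \<alpha>" "\<alpha> < \<beta>" "\<beta> < 1" "\<And>x. x \<notin> {\<alpha>..\<beta>} \<Longrightarrow> \<phi> x = 0"
proof -
  obtain D where D: "\<And>x. (\<phi> has_real_derivative D x) (at x)" "continuous_on UNIV D"
    using assms
    unfolding test_fun_def C1_differentiable_on_def has_real_derivative_iff_has_vector_derivative by blast
  have [simp]: "deriv \<phi> = D" using D(1) by (auto intro: DERIV_imp_deriv)
  let ?S = "closure {t. \<phi> t \<noteq> 0}"
  have S: "?S \<subseteq> {0<..<1}" using assms by (simp add: test_fun_def)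
  then have "bounded ?S" by (intro bounded_subset[OF bounded_closed_interval[of 0 1]] subsetI) (auto dest: subsetD)
  then have c: "compact ?S" by (simp add: compact_eq_bounded_closed)
  obtain \<alpha> \<beta> where ab: "0 < \<alpha>" "\<beta> < 1" "?S \<subseteq> {\<alpha>..\<beta>}"
  proof (cases "?S = {}")
    case True then show ?thesis using that[of "1/2" "1/2"] by auto
  next
    case False
    obtain a where "a \<in> ?S" "\<And>t. t \<in> ?S \<Longrightarrow> a \<le> t" using compact_attains_inf[OF c False] by blast
    moreover obtain b where "b \<in> ?S" "\<And>t. t \<in> ?S \<Longrightarrow> t \<le> b" using compact_attains_sup[OF c False] by blast
    ultimately show ?thesis using that[of a b] S by fastforce
  qed
  show thesis
  \<comment> \<open>Widening the interval to contain [1/4, 1/2] ensures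
    \<open>\<alpha> < \<beta>\<close> even when the support is empty.\<close>
  proof (rule that[of "min \<alpha> (1/4)" "max \<beta> (1/2)"])
    fix x assume "x \<notin> {min \<alpha> (1/4)..max \<beta> (1/2)}"
    then have "x \<notin> ?S" using subsetD[OF ab(3), of x] by auto
    then show "\<phi> x = 0" using closure_subset[of "{t. \<phi> t \<noteq> 0}"] by auto
  qed (use ab D in auto)
qed

text \<open>A C1 gluing of zero and a parabola. The only delicate point is 0, where the difference
  quotient is bounded by \<open>|h|\<close>.\<close>

lemma DERIV_max_zero_squared:
  "((\<lambda>x. (max 0 x)\<^sup>2) has_real_derivative 2 * max 0 x) (at (x::real))"
proof -
  consider "x > 0" | "x < 0" | "x = 0" by linarith
  then show ?thesis
  proof cases
    case 1
    show ?thesis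
      by (rule has_field_derivative_transform_within_open[where f = "\<lambda>x. x\<^sup>2" and S = "{0<..}"])
        (use 1 in \<open>auto intro!: derivative_eq_intros\<close>)
  next
    case 2
    show ?thesis
      by (rule has_field_derivative_transform_within_open[where f = "\<lambda>x. 0" and S = "{..<0}"])
        (use 2 in auto)
  next
    case 3
    have "((\<lambda>h. max 0 h * max 0 h / h) \<longlongrightarrow> 0) (at (0::real))"
    proof (rule Lim_null_comparison)
      show "\<forall>\<^sub>F h in at 0. norm (max 0 h * max 0 h / h) \<le> \<bar>h\<bar>" for h :: real
        by (intro always_eventually) (auto simp: max_def)
      show "((\<lambda>h. \<bar>h\<bar>) \<longlongrightarrow> 0) (at (0::real))"
        using tendsto_rabs[OF tendsto_ident_at, of "0::real" UNIV] by simp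
    qed
    then show ?thesis using 3 unfolding DERIV_def by (simp add: power2_eq_square)
  qed
qed

text \<open>Test functions are only asked to be C1, so squared positive parts take the place of
  exp(-1/x) in the usual cutoff. The denominator is positive because \<open>x\<close> and
  \<open>1 - x\<close> are never both nonpositive.\<close>

definition smooth_step :: "real \<Rightarrow> real" where
  "smooth_step x = (max 0 x)\<^sup>2 / ((max 0 x)\<^sup>2 + (max 0 (1 - x))\<^sup>2)"

lemma smooth_step_denominator: "(max 0 x)\<^sup>2 + (max 0 (1 - x))\<^sup>2 > (0::real)"
  by (cases "x > 0") (auto intro: add_pos_nonneg add_nonneg_pos)

lemma smooth_step_C1:
  "\<exists>D. (\<forall>x. (smooth_step has_real_derivative D x) (at x)) \<and> continuous_on UNIV D"
proof -
  define k where "k x = (max 0 x)\<^sup>2" for x :: real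
  have k: "(k has_real_derivative 2 * max 0 x) (at x)" for x
    unfolding k_def by (rule DERIV_max_zero_squared)
  have k1: "((\<lambda>x. k (1 - x)) has_real_derivative - 2 * max 0 (1 - x)) (at x)" for x
  proof -
    have "((\<lambda>x. 1 - x) has_real_derivative -1) (at x)" by (auto intro!: derivative_eq_intros)
    from DERIV_chain2[OF k this] show ?thesis by simp
  qed
  have pos: "k x + k (1 - x) > 0" for x
    using smooth_step_denominator[of x] by (simp add: k_def)
  have eq: "smooth_step = (\<lambda>x. k x / (k x + k (1 - x)))"
    by (auto simp: smooth_step_def k_def)
  let ?D = "\<lambda>x. (2 * max 0 x * (k x + k (1 - x)) - k x * (2 * max 0 x + - 2 * max 0 (1 - x))) /
      ((k x + k (1 - x)) * (k x + k (1 - x)))"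
  have "(smooth_step has_real_derivative ?D x) (at x)" for x
    unfolding eq using pos[of x] by (intro DERIV_divide DERIV_add k k1) auto
  moreover have "continuous_on UNIV ?D"
  proof -
    have "continuous_on UNIV k" unfolding k_def by (intro continuous_intros)
    moreover have "continuous_on UNIV (\<lambda>x. k (1 - x))" unfolding k_def by (intro continuous_intros)
    ultimately show ?thesis using pos by (intro continuous_intros) (auto simp: less_imp_neq[THEN not_sym])
  qed
  ultimately show ?thesis by (intro exI[of _ ?D] conjI allI)
qed

lemma smooth_step_bounds: "0 \<le> smooth_step x" "smooth_step x \<le> 1"
  using smooth_step_denominator[of x] by (auto simp: smooth_step_def divide_simps)

lemma smooth_step_eq: "x \<le> 0 \<Longrightarrow> smooth_step x = 0" "x \<ge> 1 \<Longrightarrow> smooth_step x = 1"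
  by (auto simp: smooth_step_def)

definition bump :: "real \<Rightarrow> real \<Rightarrow> nat \<Rightarrow> real \<Rightarrow> real" where
  "bump a b n x = smooth_step (real n * (x - a) - 1) * smooth_step (real n * (b - x) - 1)"

lemma test_fun_bump:
  assumes "0 \<le> a" "b \<le> 1" "n > 0"
  shows "test_fun (bump a b n)"
proof -
  obtain D where D: "\<And>x. (smooth_step has_real_derivative D x) (at x)" "continuous_on UNIV D"
    using smooth_step_C1 by blast
  have cs: "continuous_on UNIV smooth_step"
    using D(1) by (auto intro!: continuous_at_imp_continuous_on DERIV_isCont)
  let ?l = "\<lambda>x. real n * (x - a) - 1" and ?r = "\<lambda>x. real n * (b - x) - 1"
  let ?D = "\<lambda>x. (D (?l x) * real n) * smooth_step (?r x) + (D (?r x) * (- real n)) * smooth_step (?l x)"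
  show ?thesis
  proof (rule test_funI)
    fix x
    have "((\<lambda>x. smooth_step (?l x)) has_real_derivative D (?l x) * real n) (at x)"
      by (rule DERIV_chain2[OF D(1)]) (auto intro!: derivative_eq_intros)
    moreover have "((\<lambda>x. smooth_step (?r x)) has_real_derivative D (?r x) * (- real n)) (at x)"
      by (rule DERIV_chain2[OF D(1)]) (auto intro!: derivative_eq_intros)
    ultimately show "(bump a b n has_real_derivative ?D x) (at x)"
      unfolding bump_def by (rule DERIV_mult)
  next
    show "continuous_on UNIV ?D"
      by (intro continuous_intros continuous_on_compose2[OF D(2)] continuous_on_compose2[OF cs]) auto
    have "1 / real n > 0" using assms by simp
    then show "0 < a + 1 / n" "b - 1 / n < 1" using assms by linarith+
    fix x assume x: "x \<notin> {a + 1 / n..b - 1 / n}"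
    show "bump a b n x = 0"
    proof (cases "x < a + 1 / n")
      case True
      then have "real n * (x - a) - 1 \<le> 0" using assms by (auto simp: field_simps)
      then show ?thesis by (simp add: bump_def smooth_step_eq)
    next
      case False
      then have "x > b - 1 / n" using x by auto
      then have "real n * (b - x) - 1 \<le> 0" using assms by (auto simp: field_simps)
      then show ?thesis by (simp add: bump_def smooth_step_eq)
    qed
  qed
qed

lemma bump_bounds: "0 \<le> bump a b n x" "bump a b n x \<le> 1"
  using smooth_step_bounds by (auto simp: bump_def intro!: mult_le_one)

lemma bump_tendsto: "(\<lambda>n. bump a b (Suc n) x) \<longlonglongrightarrow> indicator {a<..<b} x"
proof (cases "x \<in> {a<..<b}")
  case True
  have "\<forall>\<^sub>F n in sequentially. 2 / (x - a) \<le> real (Suc n)" "\<forall>\<^sub>F n in sequentially. 2 / (b - x) \<le> real (Suc n)"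
    by real_asymp+
  then have "\<forall>\<^sub>F n in sequentially. bump a b (Suc n) x = 1"
  proof eventually_elim
    case (elim n)
    then have "real (Suc n) * (x - a) - 1 \<ge> 1" "real (Suc n) * (b - x) - 1 \<ge> 1"
      using True by (auto simp: pos_divide_le_eq)
    then show ?case by (simp add: bump_def smooth_step_eq del: of_nat_Suc)
  qed
  then show ?thesis using True by (simp add: tendsto_eventually)
next
  case False
  have "bump a b (Suc n) x = 0" for n
  proof (cases "x \<le> a")
    case True
    then have "real (Suc n) * (x - a) - 1 \<le> 0"
      by (smt (verit) mult_nonneg_nonpos of_nat_0_le_iff)
    then show ?thesis by (simp add: bump_def smooth_step_eq del: of_nat_Suc)
  next
    case f: False
    then have "real (Suc n) * (b - x) - 1 \<le> 0" using False
      by (smt (verit) mult_nonneg_nonpos of_nat_0_le_iff greaterThanLessThan_iff)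
    then show ?thesis by (simp add: bump_def smooth_step_eq del: of_nat_Suc)
  qed
  then show ?thesis using False by simp
qed

lemma test_fun_continuous: "test_fun \<phi> \<Longrightarrow> continuous_on {0..1} \<phi>"
  by (erule test_funE) (meson DERIV_isCont continuous_at_imp_continuous_on)

text \<open>The fundamental lemma of the calculus of variations. Testing with bumps and passing to
  the limit by dominated convergence gives zero integrals over every \<open>(a,1)\<close>; extended
  by zero to the line, \<open>h\<close> then has zero integrals over all half-lines.\<close>

lemma AE_zero_of_test_fun_integrals:
  assumes h: "integrable \<mu> h" and test: "\<And>\<phi>. test_fun \<phi> \<Longrightarrow> (LINT t|\<mu>. h t * \<phi> t) = 0"
  shows "AE t in \<mu>. h t = 0"
proof -
  have zero: "(LINT t|\<mu>. h t * indicator {a<..<1} t) = 0" if a: "0 \<le> a" for a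
  proof -
    have "(\<lambda>n. LINT t|\<mu>. h t * bump a 1 (Suc n) t) \<longlonglongrightarrow> (LINT t|\<mu>. h t * indicator {a<..<1} t)"
    proof (rule integral_dominated_convergence)
      show "integrable \<mu> (\<lambda>t. \<bar>h t\<bar>)" using h by simp
      show "(\<lambda>t. h t * indicator {a<..<1} t) \<in> borel_measurable \<mu>"
        using integral_mu_cut(1)[OF h] by (auto intro: borel_measurable_integrable)
      show "(\<lambda>t. h t * bump a 1 (Suc n) t) \<in> borel_measurable \<mu>" for n
        using h borel_measurable_mu_of_continuous[OF test_fun_continuous[OF test_fun_bump[of a 1 "Suc n"]]] a
        by measurable
      show "AE t in \<mu>. (\<lambda>n. h t * bump a 1 (Suc n) t) \<longlonglongrightarrow> h t * indicator {a<..<1} t"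
        by (intro AE_I2 tendsto_mult bump_tendsto tendsto_const)
      show "AE t in \<mu>. norm (h t * bump a 1 (Suc n) t) \<le> \<bar>h t\<bar>" for n
        using bump_bounds by (intro AE_I2) (simp add: abs_mult mult_left_le)
    qed
    moreover have "(LINT t|\<mu>. h t * bump a 1 (Suc n) t) = 0" for n
      using a by (intro test test_fun_bump) auto
    ultimately show ?thesis by (simp add: LIMSEQ_const_iff)
  qed
  let ?h = "\<lambda>t. indicator {0<..<1} t *\<^sub>R h t"
  have "AE t in lebesgue. ?h t = 0"
  proof (rule AE_zero_of_half_line_integrals)
    show "integrable lebesgue ?h" using h by (simp add: integrable_restrict_space)
    have total: "(LINT t|lebesgue. ?h t) = (LINT t|\<mu>. h t)" by (simp add: integral_restrict_space)
    also have "\<dots> = (LINT t|\<mu>. h t * indicator {0<..<1} t)"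
      by (rule Bochner_Integration.integral_cong) (auto simp: indicator_def)
    finally show "(LINT t|lebesgue. ?h t) = 0" using zero[of 0] by simp
    fix a :: real
    have "(LINT t:{a<..}|lebesgue. ?h t) = (LINT t|lebesgue. indicator {0<..<1} t *\<^sub>R (h t * indicator {max 0 a<..<1} t))"
      unfolding set_lebesgue_integral_def
      by (rule Bochner_Integration.integral_cong) (auto simp: indicator_def)
    also have "\<dots> = (LINT t|\<mu>. h t * indicator {max 0 a<..<1} t)"
      by (simp add: integral_restrict_space)
    finally show "(LINT t:{a<..}|lebesgue. ?h t) = 0" using zero[of "max 0 a"] by simp
  qed
  then have "AE t in lebesgue. t \<in> {0<..<1} \<longrightarrow> h t = 0"
    by (rule eventually_mono) (simp add: indicator_def split: if_splits)
  then show ?thesis by (subst AE_restrict_space_iff) auto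
qed

section \<open>Weak derivatives and primitives\<close>

lemma integral_mu_mult_test_fun_diff:
  fixes v w \<phi> :: "real \<Rightarrow> real"
  assumes "integrable \<mu> v" "integrable \<mu> w" "continuous_on {0..1} \<phi>"
  shows "(LINT t|\<mu>. (v t - w t) * \<phi> t) = (LINT t|\<mu>. v t * \<phi> t) - (LINT t|\<mu>. w t * \<phi> t)"
  using integrable_mu_mult_continuous[OF assms(3,1)] integrable_mu_mult_continuous[OF assms(3,2)]
  by (simp add: right_diff_distrib mult.commute[of _ "\<phi> _"])

lemma weak_deriv_unique:
  assumes "integrable \<mu> v" "integrable \<mu> w" "is_weak_deriv u v" "is_weak_deriv u w"
  shows "AE t in \<mu>. v t = w t"
proof -
  have "AE t in \<mu>. v t - w t = 0"
  proof (rule AE_zero_of_test_fun_integrals)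
    fix \<phi> assume \<phi>: "test_fun \<phi>"
    then show "(LINT t|\<mu>. (v t - w t) * \<phi> t) = 0"
      using assms(3,4) integral_mu_mult_test_fun_diff[OF assms(1,2) test_fun_continuous[OF \<phi>]]
      by (fastforce simp: is_weak_deriv_def)
  qed (use assms in auto)
  then show ?thesis by simp
qed

lemma integral_deriv_test_fun:
  assumes "test_fun \<phi>" "s \<le> 1" shows "integral {s..1} (deriv \<phi>) = - \<phi> s"
proof -
  obtain \<alpha> \<beta> where D: "\<And>x. (\<phi> has_real_derivative deriv \<phi> x) (at x)" and "\<beta> < 1"
    and z: "\<And>x. x \<notin> {\<alpha>..\<beta>} \<Longrightarrow> \<phi> x = 0" using assms(1) by (rule test_funE) blast
  have "(deriv \<phi> has_integral (\<phi> 1 - \<phi> s)) {s..1}"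
    using assms(2) D by (intro fundamental_theorem_of_calculus)
      (auto simp: has_real_derivative_iff_has_vector_derivative[symmetric] intro: has_field_derivative_at_within)
  then show ?thesis using z[of 1] \<open>\<beta> < 1\<close> by (simp add: integral_unique)
qed

lemma continuous_on_integral_mu:
  fixes p :: "real \<Rightarrow> real"
  assumes "integrable \<mu> p" shows "continuous_on {0..1} (\<lambda>t. integral {0..t} p)"
  by (rule indefinite_integral_continuous_1) (rule integral_mu_eq(1)[OF assms])

text \<open>The triangle identity with \<open>q = deriv \<phi>\<close> produces the inner integral
  \<open>- \<phi> s\<close>, and the constant drops out because \<open>deriv \<phi>\<close> has
  integral zero. Equality is assumed only almost everywhere so that the lemma applies to a
  representative chosen by \<open>weak_deriv\<close>.\<close>

lemma is_weak_deriv_primitive: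
  assumes u: "integrable \<mu> u" and p: "integrable \<mu> p"
    and eq: "AE t in \<mu>. u t = c + integral {0..t} p"
  shows "is_weak_deriv u p"
  unfolding is_weak_deriv_def
proof (intro allI impI)
  fix \<phi> assume \<phi>: "test_fun \<phi>"
  then have cd: "continuous_on {0..1} (deriv \<phi>)"
    by (elim test_funE) (auto intro: continuous_on_subset)
  note ci = continuous_on_integral_mu[OF p]
  have i: "integrable \<mu> (\<lambda>t. c * deriv \<phi> t)" "integrable \<mu> (\<lambda>t. deriv \<phi> t * integral {0..t} p)"
    by (intro integrable_mu_of_continuous continuous_intros cd ci)+
  have "(LINT t|\<mu>. u t * deriv \<phi> t) = (LINT t|\<mu>. c * deriv \<phi> t + deriv \<phi> t * integral {0..t} p)"
  proof (rule integral_cong_AE)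
    show "AE t in \<mu>. u t * deriv \<phi> t = c * deriv \<phi> t + deriv \<phi> t * integral {0..t} p"
      using eq by eventually_elim (simp add: algebra_simps)
    show "(\<lambda>t. u t * deriv \<phi> t) \<in> borel_measurable \<mu>"
      using u borel_measurable_mu_of_continuous[OF cd] by measurable
  qed (use i in auto)
  also have "\<dots> = c * (LINT t|\<mu>. deriv \<phi> t) + (LINT s|\<mu>. p s * integral {s..1} (deriv \<phi>))"
    using i integral_mu_triangle[OF p cd] by simp
  also have "(LINT t|\<mu>. deriv \<phi> t) = - \<phi> 0"
    using integral_mu_eq(2)[OF integrable_mu_of_continuous[OF cd]] integral_deriv_test_fun[OF \<phi>, of 0] by simp
  also have "\<phi> 0 = 0" using \<phi> by (elim test_funE) auto
  also have "(LINT s|\<mu>. p s * integral {s..1} (deriv \<phi>)) = (LINT s|\<mu>. - (p s * \<phi> s))"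
    by (rule Bochner_Integration.integral_cong) (simp_all add: integral_deriv_test_fun[OF \<phi>])
  finally show "(LINT t|\<mu>. u t * deriv \<phi> t) = - (LINT t|\<mu>. p t * \<phi> t)" by simp
qed

lemma test_fun_lincomb:
  assumes "test_fun \<phi>" "test_fun \<psi>" shows "test_fun (\<lambda>x. a * \<phi> x + b * \<psi> x)"
proof -
  obtain \<alpha> \<beta> where 1: "\<And>x. (\<phi> has_real_derivative deriv \<phi> x) (at x)" "continuous_on UNIV (deriv \<phi>)"
    "0 < \<alpha>" "\<beta> < 1" "\<And>x. x \<notin> {\<alpha>..\<beta>} \<Longrightarrow> \<phi> x = 0" using assms(1) by (rule test_funE) blast
  obtain \<alpha>' \<beta>' where 2: "\<And>x. (\<psi> has_real_derivative deriv \<psi> x) (at x)" "continuous_on UNIV (deriv \<psi>)"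
    "0 < \<alpha>'" "\<beta>' < 1" "\<And>x. x \<notin> {\<alpha>'..\<beta>'} \<Longrightarrow> \<psi> x = 0" using assms(2) by (rule test_funE) blast
  show ?thesis
  proof (rule test_funI)
    show "((\<lambda>x. a * \<phi> x + b * \<psi> x) has_real_derivative a * deriv \<phi> x + b * deriv \<psi> x) (at x)" for x
      by (intro DERIV_add DERIV_cmult 1 2)
    show "continuous_on UNIV (\<lambda>x. a * deriv \<phi> x + b * deriv \<psi> x)"
      by (intro continuous_intros 1 2)
    show "0 < min \<alpha> \<alpha>'" "max \<beta> \<beta>' < 1" using 1 2 by auto
    show "a * \<phi> x + b * \<psi> x = 0" if "x \<notin> {min \<alpha> \<alpha>'..max \<beta> \<beta>'}" for x
    proof -
      have "x \<notin> {\<alpha>..\<beta>}" "x \<notin> {\<alpha>'..\<beta>'}"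
        using that by (auto simp: min_le_iff_disj le_max_iff_disj)
      then show ?thesis using 1(5) 2(5) by simp
    qed
  qed
qed

lemma test_fun_antiderivative:
  assumes q: "test_fun q" and zero: "integral {0..1} q = 0"
  obtains \<phi> where "test_fun \<phi>" "deriv \<phi> = q"
proof -
  obtain \<alpha> \<beta> where D: "\<And>x. (q has_real_derivative deriv q x) (at x)"
    and ab: "0 < \<alpha>" "\<beta> < 1" and z: "\<And>x. x \<notin> {\<alpha>..\<beta>} \<Longrightarrow> q x = 0"
    using q by (rule test_funE) blast
  have cq: "continuous_on A q" for A
    using D by (meson DERIV_isCont continuous_at_imp_continuous_on)
  \<comment> \<open>The base point -1 lies left of the support, so each
    \<open>t \<ge> \<alpha>\<close> is interior to \<open>{-1..t + 1}\<close> and the derivative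
    there is two-sided. The zero mean makes \<open>\<phi>\<close> vanish beyond
    \<open>\<beta>\<close>.\<close>
  define \<phi> where "\<phi> t = integral {-1..t} q" for t
  have cut: "integral T q = integral ({\<alpha>..\<beta>} \<inter> T) q" for T
  proof -
    have "(\<lambda>x. if x \<in> {\<alpha>..\<beta>} then q x else 0) = q" using z by auto
    then show ?thesis using Henstock_Kurzweil_Integration.integral_restrict_Int[of T "{\<alpha>..\<beta>}" q] by simp
  qed
  have left: "\<phi> t = 0" if "t < \<alpha>" for t
  proof -
    have "{\<alpha>..\<beta>} \<inter> {-1..t} = {}" using that by auto
    then show ?thesis using cut[of "{-1..t}"] by (simp add: \<phi>_def)
  qed
  have right: "\<phi> t = 0" if "t > \<beta>" for t
  proof -
    have *: "{\<alpha>..\<beta>} \<inter> {-1..t} = {\<alpha>..\<beta>} \<inter> {0..1}" using that ab by auto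
    show ?thesis unfolding \<phi>_def by (subst cut) (simp only: * cut[of "{0..1}", symmetric] zero)
  qed
  have \<phi>: "(\<phi> has_real_derivative q t) (at t)" for t
  proof (cases "t < \<alpha>")
    case True
    have "((\<lambda>_. 0) has_real_derivative 0) (at t)" by simp
    then have "(\<phi> has_real_derivative 0) (at t)"
      by (rule has_field_derivative_transform_within_open[where S = "{..<\<alpha>}"]) (use True left in auto)
    then show ?thesis using z[of t] True by simp
  next
    case False
    then have "(\<phi> has_real_derivative q t) (at t within {-1..t + 1})"
      unfolding \<phi>_def using ab by (intro integral_has_real_derivative cq) auto
    then show ?thesis using at_within_Icc_at[of "-1" t "t + 1"] False ab by simp
  qed
  have "test_fun \<phi>"
    using \<phi> cq ab left right by (intro test_funI[of \<phi> q \<alpha> \<beta>]) fastforce+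
  moreover have "deriv \<phi> = q" using \<phi> by (auto intro: DERIV_imp_deriv)
  ultimately show thesis using that by blast
qed

text \<open>The lemma of du Bois-Reymond: subtracting a multiple of a fixed test function of nonzero
  integral turns any test function into the derivative of a test function.\<close>

lemma weak_deriv_imp_primitive:
  assumes u: "integrable \<mu> u" and p: "integrable \<mu> p" and up: "is_weak_deriv u p"
  obtains c where "AE t in \<mu>. u t = c + integral {0..t} p"
proof -
  \<comment> \<open>What remains after subtracting the primitive of \<open>p\<close> has weak
    derivative zero and must be shown to be constant.\<close>
  define k where "k t = u t - integral {0..t} p" for t
  note iP = integrable_mu_of_continuous[OF continuous_on_integral_mu[OF p]]
  have k: "integrable \<mu> k" unfolding k_def using u iP by auto
  have k_deriv: "(LINT t|\<mu>. k t * deriv \<phi> t) = 0" if \<phi>: "test_fun \<phi>" for \<phi>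
  proof -
    have cd: "continuous_on {0..1} (deriv \<phi>)"
      using \<phi> by (elim test_funE) (auto intro: continuous_on_subset)
    have "is_weak_deriv (\<lambda>t. integral {0..t} p) p"
      by (rule is_weak_deriv_primitive[OF iP p, of 0]) simp
    then show ?thesis unfolding k_def
      using up \<phi> integral_mu_mult_test_fun_diff[OF u iP cd] by (simp add: is_weak_deriv_def)
  qed
  \<comment> \<open>If every test function had integral zero, the fundamental lemma applied to the
    constant 1 would give 1 = 0.\<close>
  obtain \<rho> where \<rho>: "test_fun \<rho>" "(LINT t|\<mu>. \<rho> t) \<noteq> 0"
  proof (rule ccontr)
    assume "\<not> thesis"
    then have "AE t in \<mu>. (1::real) = 0"
      using that by (intro AE_zero_of_test_fun_integrals) auto
    then have "(LINT t|\<mu>. 1) = (LINT t|\<mu>. 0::real)"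
      by (intro integral_cong_AE) auto
    then show False unfolding integral_mu_const by simp
  qed
  note c\<rho> = test_fun_continuous[OF \<rho>(1)]
  \<comment> \<open>The only possible value of the constant, found by testing \<open>k = c\<close>
    against \<open>\<rho>\<close>.\<close>
  define c where "c = (LINT t|\<mu>. k t * \<rho> t) / (LINT t|\<mu>. \<rho> t)"
  have "AE t in \<mu>. k t - c = 0"
  proof (rule AE_zero_of_test_fun_integrals)
    fix \<psi> assume \<psi>: "test_fun \<psi>"
    note c\<psi> = test_fun_continuous[OF \<psi>]
    note int = integrable_mu_of_continuous[OF c\<psi>] integrable_mu_of_continuous[OF c\<rho>]
      integrable_mu_mult_continuous[OF c\<psi> k] integrable_mu_mult_continuous[OF c\<rho> k]
    define m where "m = (LINT t|\<mu>. \<psi> t) / (LINT t|\<mu>. \<rho> t)"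
    let ?q = "\<lambda>t. 1 * \<psi> t + (- m) * \<rho> t"
    have q: "test_fun ?q" by (rule test_fun_lincomb[OF \<psi> \<rho>(1)])
    have "integral {0..1} ?q = (LINT t|\<mu>. ?q t)"
      by (rule integral_mu_eq(2)[symmetric]) (intro integrable_mu_of_continuous test_fun_continuous q)
    also have "\<dots> = 0" using int \<rho>(2) by (simp add: m_def)
    finally obtain \<phi> where \<phi>: "test_fun \<phi>" "deriv \<phi> = ?q"
      by (rule test_fun_antiderivative[OF q])
    have "(LINT t|\<mu>. k t * ?q t) = 0" using k_deriv[OF \<phi>(1)] \<phi>(2) by simp
    moreover have "(LINT t|\<mu>. k t * ?q t) = (LINT t|\<mu>. \<psi> t * k t - m * (\<rho> t * k t))"
      by (rule Bochner_Integration.integral_cong) (auto simp: algebra_simps)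
    ultimately have "(LINT t|\<mu>. \<psi> t * k t) = m * (LINT t|\<mu>. \<rho> t * k t)"
      using int by simp
    also have "\<dots> = c * (LINT t|\<mu>. \<psi> t)"
      by (simp add: m_def c_def mult.commute)
    finally show "(LINT t|\<mu>. (k t - c) * \<psi> t) = 0"
      using integral_mu_mult_test_fun_diff[OF k integrable_mu_const c\<psi>, of c] by (simp add: mult.commute)
  qed (use k in auto)
  then have "AE t in \<mu>. u t = c + integral {0..t} p"
    by eventually_elim (simp add: k_def)
  then show thesis by (rule that)
qed

lemma eq_of_AE_eq_continuous:
  fixes u v :: "real \<Rightarrow> real"
  assumes "continuous_on {0..1} u" "continuous_on {0..1} v" "AE t in \<mu>. u t = v t" "t \<in> {0..1}"
  shows "u t = v t"
proof -
  have c: "continuous_on {0..1} (\<lambda>t. \<bar>u t - v t\<bar>)" using assms by (intro continuous_intros)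
  have "(LINT t|\<mu>. \<bar>u t - v t\<bar>) = 0"
    using assms(3) by (intro integral_eq_zero_AE) (auto elim: eventually_mono)
  then have "integral {0..1} (\<lambda>t. \<bar>u t - v t\<bar>) = 0"
    using integral_mu_eq(2)[OF integrable_mu_of_continuous[OF c]] by simp
  then have "\<forall>t\<in>{0..1}. \<bar>u t - v t\<bar> = 0"
    by (subst (asm) integral_eq_0_iff[OF c]) auto
  then show ?thesis using assms(4) by simp
qed

text \<open>Once a single weak derivative in \<open>L2\<close> is known, the representative picked
  by \<open>SOME\<close> is controlled up to a null set.\<close>

lemma weak_deriv_works:
  assumes "v \<in> L2" "is_weak_deriv u v"
  shows "weak_deriv u \<in> L2" "is_weak_deriv u (weak_deriv u)" "AE t in \<mu>. weak_deriv u t = v t"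
proof -
  have "weak_deriv u \<in> L2 \<and> is_weak_deriv u (weak_deriv u)"
    unfolding weak_deriv_def by (rule someI[of _ v]) (use assms in blast)
  then show *: "weak_deriv u \<in> L2" "is_weak_deriv u (weak_deriv u)" by auto
  show "AE t in \<mu>. weak_deriv u t = v t"
    using * assms by (intro weak_deriv_unique L2_integrable)
qed

section \<open>Elements of X as double primitives\<close>

definition double_primitive :: "(real \<Rightarrow> real) \<Rightarrow> real \<Rightarrow> real" where
  "double_primitive g t = (if t \<in> {0..1} then integral {0..t} (\<lambda>s. integral {0..s} g) else 0)"

lemma double_primitive_deriv:
  assumes "integrable \<mu> g" "t \<in> {0..1}"
  shows "(double_primitive g has_real_derivative integral {0..t} g) (at t within {0..1})"
proof -
  have "((\<lambda>t. integral {0..t} (\<lambda>s. integral {0..s} g)) has_real_derivative integral {0..t} g) (at t within {0..1})"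
    by (rule integral_has_real_derivative[OF continuous_on_integral_mu[OF assms(1)] assms(2)])
  then show ?thesis
    by (rule has_field_derivative_transform_within[OF _ zero_less_one assms(2)]) (simp add: double_primitive_def)
qed

lemma continuous_on_double_primitive:
  "integrable \<mu> g \<Longrightarrow> continuous_on {0..1} (double_primitive g)"
  by (rule DERIV_continuous_on, rule double_primitive_deriv)

text \<open>With \<open>X_double_primitive\<close> below, this identifies \<open>X\<close> with
  \<open>L2\<close> modulo null sets through the second derivative; later computations in
  \<open>X\<close> go through this identification.\<close>

lemma double_primitive_X:
  assumes g: "g \<in> L2"
  shows "double_primitive g \<in> X"
    and "AE t in \<mu>. weak_deriv (weak_deriv (double_primitive g)) t = g t"
proof -
  let ?u = "double_primitive g" and ?G = "\<lambda>t. integral {0..t} g"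
  note ig = L2_integrable[OF g]
  have cG: "continuous_on {0..1} ?G" by (rule continuous_on_integral_mu[OF ig])
  have cu: "continuous_on {0..1} ?u" by (rule continuous_on_double_primitive[OF ig])
  have "AE t in \<mu>. ?u t = 0 + integral {0..t} ?G"
    by (rule AE_I2) (auto simp: double_primitive_def)
  then have wu: "is_weak_deriv ?u ?G"
    by (intro is_weak_deriv_primitive integrable_mu_of_continuous cG cu)
  note wd = weak_deriv_works[OF L2_of_continuous[OF cG] wu]
  have "AE t in \<mu>. weak_deriv ?u t = 0 + ?G t"
    using wd(3) by simp
  then have wg: "is_weak_deriv (weak_deriv ?u) g"
    by (intro is_weak_deriv_primitive L2_integrable wd g)
  note wd' = weak_deriv_works[OF g wg]
  show "AE t in \<mu>. weak_deriv (weak_deriv ?u) t = g t" by (rule wd'(3))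
  have "?u \<in> H2"
    using wd wg g wu L2_of_continuous[OF cu] L2_of_continuous[OF cG] by (auto simp: H2_def H1_def)
  moreover have "(?u has_real_derivative 0) (at 0 within {0..1})"
    using double_primitive_deriv[OF ig, of 0] by simp
  ultimately show "?u \<in> X" using cu by (auto simp: X_def double_primitive_def)
qed

text \<open>Du Bois-Reymond, applied twice, determines \<open>u\<close> up to two constants. The
  condition \<open>u 0 = 0\<close> removes one of them, the one-sided derivative at 0 the
  other.\<close>

lemma X_double_primitive:
  assumes "u \<in> X"
  shows "weak_deriv (weak_deriv u) \<in> L2" "u = double_primitive (weak_deriv (weak_deriv u))"
proof -
  let ?p = "weak_deriv u" and ?g = "weak_deriv (weak_deriv u)"
  have X: "continuous_on {0..1} u" "\<And>t. t \<notin> {0..1} \<Longrightarrow> u t = 0" "u 0 = 0"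
    "(u has_real_derivative 0) (at 0 within {0..1})" "u \<in> H1" "?p \<in> H1"
    using assms by (auto simp: X_def H2_def)
  have p: "?p \<in> L2" "is_weak_deriv u ?p" using X(5) weak_deriv_works by (auto simp: H1_def)
  have g: "?g \<in> L2" "is_weak_deriv ?p ?g" using X(6) weak_deriv_works by (auto simp: H1_def)
  show "?g \<in> L2" by fact
  note ip = L2_integrable[OF p(1)] and ig = L2_integrable[OF g(1)]
  obtain c where c: "AE t in \<mu>. ?p t = c + integral {0..t} ?g"
    using weak_deriv_imp_primitive[OF ip ig g(2)] by blast
  have cG: "continuous_on {0..1} (\<lambda>t. c + integral {0..t} ?g)"
    by (intro continuous_intros continuous_on_integral_mu ig)
  then have iG: "integrable \<mu> (\<lambda>t. c + integral {0..t} ?g)"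
    by (rule integrable_mu_of_continuous)
  \<comment> \<open>The weak derivative is replaced by its continuous representative, which turns
    \<open>u\<close> into a classical primitive whose derivative at 0 can be read off as
    \<open>c\<close>.\<close>
  have "is_weak_deriv u (\<lambda>t. c + integral {0..t} ?g)"
    unfolding is_weak_deriv_def
  proof (intro allI impI)
    fix \<phi> assume \<phi>: "test_fun \<phi>"
    have "(LINT t|\<mu>. ?p t * \<phi> t) = (LINT t|\<mu>. (c + integral {0..t} ?g) * \<phi> t)"
    proof (rule integral_cong_AE)
      show "AE t in \<mu>. ?p t * \<phi> t = (c + integral {0..t} ?g) * \<phi> t"
        using c by eventually_elim simp
    qed (use ip iG borel_measurable_mu_of_continuous[OF test_fun_continuous[OF \<phi>]] in measurable)
    then show "(LINT t|\<mu>. u t * deriv \<phi> t) = - (LINT t|\<mu>. (c + integral {0..t} ?g) * \<phi> t)"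
      using p(2) \<phi> by (simp add: is_weak_deriv_def)
  qed
  then obtain d where d: "AE t in \<mu>. u t = d + integral {0..t} (\<lambda>s. c + integral {0..s} ?g)"
    using weak_deriv_imp_primitive[OF integrable_mu_of_continuous[OF X(1)] iG] by blast
  have eq: "u t = d + integral {0..t} (\<lambda>s. c + integral {0..s} ?g)" if "t \<in> {0..1}" for t
    by (rule eq_of_AE_eq_continuous[OF X(1) _ d that])
      (intro continuous_intros continuous_on_integral_mu iG)
  have "d = 0" using eq[of 0] X(3) by simp
  have "((\<lambda>t. integral {0..t} (\<lambda>s. c + integral {0..s} ?g)) has_real_derivative c + integral {0..0} ?g) (at 0 within {0..1})"
    by (rule integral_has_real_derivative[OF cG]) simp
  then have "(u has_real_derivative c) (at 0 within {0..1})"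
    by (intro has_field_derivative_transform_within[OF _ zero_less_one, where g = u]) (auto simp: eq \<open>d = 0\<close>)
  then have "c = 0"
    using X(4) by (rule has_field_derivative_unique) (simp add: at_within_Icc_at_right)
  show "u = double_primitive ?g"
    using X(2) by (auto simp: fun_eq_iff double_primitive_def eq \<open>d = 0\<close> \<open>c = 0\<close>)
qed

section \<open>The space X as an inner product space\<close>

lemma integral_initial_segment:
  fixes p :: "real \<Rightarrow> real"
  assumes "integrable \<mu> p" "s \<in> {0..1}"
  shows "integral {0..s} p = (LINT t|\<mu>. p t * indicator {..s} t)"
proof -
  have *: "{0..1} \<inter> {..s} = {0..s}" using assms(2) by auto
  show ?thesis using integral_mu_cut(2)[OF assms(1), of "{..s}"] unfolding * by simp
qed

lemma integral_lincomb:
  fixes g h :: "real \<Rightarrow> real"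
  assumes "g integrable_on A" "h integrable_on A"
  shows "integral A (\<lambda>t. a * g t + b * h t) = a * integral A g + b * integral A h"
  using assms by (subst integral_add) (auto intro: integrable_on_mult_right simp: integral_mult_right)

lemma integrable_on_initial_segment:
  fixes p :: "real \<Rightarrow> real"
  assumes "integrable \<mu> p" "s \<in> {0..1}"
  shows "p integrable_on {0..s}"
  using integrable_on_subinterval[OF integral_mu_eq(1)[OF assms(1)], of 0 s] assms(2) by auto

lemma double_primitive_lincomb:
  assumes g: "g \<in> L2" and h: "h \<in> L2"
  shows "double_primitive (\<lambda>t. a * g t + b * h t) = (\<lambda>t. a * double_primitive g t + b * double_primitive h t)"
proof
  fix t
  note ig = L2_integrable[OF g] and ih = L2_integrable[OF h]
  have "integral {0..t} (\<lambda>s. integral {0..s} (\<lambda>t. a * g t + b * h t)) =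
      integral {0..t} (\<lambda>s. a * integral {0..s} g + b * integral {0..s} h)" if "t \<in> {0..1}"
    using that by (intro integral_cong integral_lincomb integrable_on_initial_segment ig ih) auto
  moreover have "integral {0..t} (\<lambda>s. a * integral {0..s} g + b * integral {0..s} h) =
      a * integral {0..t} (\<lambda>s. integral {0..s} g) + b * integral {0..t} (\<lambda>s. integral {0..s} h)" if "t \<in> {0..1}"
    using that by (intro integral_lincomb integrable_on_initial_segment
        integrable_mu_of_continuous[OF continuous_on_integral_mu] ig ih)
  ultimately show "double_primitive (\<lambda>t. a * g t + b * h t) t = a * double_primitive g t + b * double_primitive h t"
    by (simp add: double_primitive_def)
qed

lemma X_lincomb:
  assumes "u \<in> X" "v \<in> X" shows "(\<lambda>t. a * u t + b * v t) \<in> X"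
proof -
  have "(\<lambda>t. a * u t + b * v t) =
      double_primitive (\<lambda>t. a * weak_deriv (weak_deriv u) t + b * weak_deriv (weak_deriv v) t)"
    using X_double_primitive[OF assms(1)] X_double_primitive[OF assms(2)]
    by (subst double_primitive_lincomb) auto
  then show ?thesis
    using double_primitive_X(1)[OF L2_lincomb] X_double_primitive(1) assms by simp
qed

lemma X_inner_double_primitive:
  assumes "g \<in> L2" "h \<in> L2"
  shows "X_inner (double_primitive g) (double_primitive h) = (LINT t|\<mu>. g t * h t)"
  unfolding X_inner_def
proof (rule integral_cong_AE)
  note g = double_primitive_X[OF assms(1)] and h = double_primitive_X[OF assms(2)]
  show "AE t in \<mu>. weak_deriv (weak_deriv (double_primitive g)) t *
      weak_deriv (weak_deriv (double_primitive h)) t = g t * h t"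
    using g(2) h(2) by eventually_elim simp
qed (use assms L2_mult_integrable X_double_primitive(1) double_primitive_X(1) in
    \<open>auto intro!: borel_measurable_integrable\<close>)

text \<open>Definiteness of the inner product: the curvature vanishes almost everywhere, so both
  integrations give exactly zero, and off [0,1] the value is zero by encoding.\<close>

lemma double_primitive_eq_zero:
  assumes g: "g \<in> L2" and "(LINT t|\<mu>. g t * g t) = 0"
  shows "double_primitive g = (\<lambda>_. 0)"
proof -
  have "AE t in \<mu>. g t * g t = 0"
    using integral_nonneg_eq_0_iff_AE[OF L2_mult_integrable[OF g g]] assms(2) by simp
  then have "AE t in \<mu>. g t = 0" by simp
  then have "integral {0..s} g = 0" if "s \<in> {0..1}" for s
    unfolding integral_initial_segment[OF L2_integrable[OF g] that]
    by (intro integral_eq_zero_AE) (auto elim: eventually_mono)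
  then have "integral {0..t} (\<lambda>s. integral {0..s} g) = 0" if "t \<in> {0..1}" for t
    using that integral_cong[of "{0..t}" "\<lambda>s. integral {0..s} g" "\<lambda>_. 0"] by simp
  then show ?thesis by (auto simp: double_primitive_def)
qed

text \<open>As a type, \<open>X\<close> can be made an instance of \<open>real_inner\<close>, so
  that limits, closed sets, continuous paths and Cauchy-Schwarz are the general notions for the norm
  \<open>X_norm\<close>.\<close>

typedef beam = X
  morphisms deflection Beam
  using double_primitive_X(1)[of "\<lambda>_. 0"] by (auto simp: L2_def)

setup_lifting type_definition_beam

definition curvature :: "beam \<Rightarrow> real \<Rightarrow> real" where
  "curvature u = weak_deriv (weak_deriv (deflection u))"

lemma curvature_L2: "curvature u \<in> L2"
  unfolding curvature_def by (rule X_double_primitive(1)[OF deflection])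

lemma deflection_eq: "deflection u = double_primitive (curvature u)"
  unfolding curvature_def by (rule X_double_primitive(2)[OF deflection])

lemma deflection_Beam_double_primitive:
  "g \<in> L2 \<Longrightarrow> deflection (Beam (double_primitive g)) = double_primitive g"
  by (rule Beam_inverse) (rule double_primitive_X(1))

instantiation beam :: real_inner
begin

lift_definition zero_beam :: beam is "\<lambda>_. 0"
  using X_lincomb[of "double_primitive (\<lambda>_. 0)" "double_primitive (\<lambda>_. 0)" 0 0]
    double_primitive_X(1)[of "\<lambda>_. 0"] by (auto simp: L2_def)

lift_definition plus_beam :: "beam \<Rightarrow> beam \<Rightarrow> beam" is "\<lambda>u v t. u t + v t"
  using X_lincomb[of _ _ 1 1] by simp

lift_definition minus_beam :: "beam \<Rightarrow> beam \<Rightarrow> beam" is "\<lambda>u v t. u t - v t"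
  using X_lincomb[of _ _ 1 "-1"] by simp

lift_definition uminus_beam :: "beam \<Rightarrow> beam" is "\<lambda>u t. - u t"
  using X_lincomb[of u u "-1" 0 for u] by simp

lift_definition scaleR_beam :: "real \<Rightarrow> beam \<Rightarrow> beam" is "\<lambda>a u t. a * u t"
  using X_lincomb[of u u a 0 for u a] by simp

lift_definition inner_beam :: "beam \<Rightarrow> beam \<Rightarrow> real" is X_inner .

lift_definition norm_beam :: "beam \<Rightarrow> real" is X_norm .

definition dist_beam :: "beam \<Rightarrow> beam \<Rightarrow> real" where "dist_beam u v = norm (u - v)"

definition sgn_beam :: "beam \<Rightarrow> beam" where "sgn_beam u = scaleR (inverse (norm u)) u"

definition uniformity_beam :: "(beam \<times> beam) filter" where
  "uniformity_beam = (INF e\<in>{0 <..}. principal {(u, v). dist u v < e})"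

definition open_beam :: "beam set \<Rightarrow> bool" where
  "open_beam U = (\<forall>u\<in>U. \<forall>\<^sub>F (u', v) in uniformity. u' = u \<longrightarrow> v \<in> U)"

lemma inner_beam_eq:
  fixes u v :: beam
  shows "inner u v = (LINT t|\<mu>. curvature u t * curvature v t)"
  by (simp add: inner_beam.rep_eq X_inner_def curvature_def)

instance
proof
  fix u v w :: beam and a :: real
  \<comment> \<open>\<open>weak_deriv\<close> is a choice and need not be additive pointwise.
    Linearity is obtained by exhibiting the combination as a double primitive, for which
    \<open>X_inner\<close> no longer depends on the choice.\<close>
  have lin: "X_inner (\<lambda>t. a * deflection u t + b * deflection v t) (deflection w) =
      a * inner u w + b * inner v w" for a b
  proof -
    have "X_inner (\<lambda>t. a * deflection u t + b * deflection v t) (deflection w) =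
        X_inner (double_primitive (\<lambda>t. a * curvature u t + b * curvature v t)) (double_primitive (curvature w))"
      by (simp add: double_primitive_lincomb curvature_L2 deflection_eq)
    also have "\<dots> = (LINT t|\<mu>. a * (curvature u t * curvature w t) + b * (curvature v t * curvature w t))"
      by (subst X_inner_double_primitive) (auto intro!: L2_lincomb curvature_L2 simp: algebra_simps)
    also have "\<dots> = a * inner u w + b * inner v w"
      using L2_mult_integrable[OF curvature_L2 curvature_L2] by (simp add: inner_beam_eq)
    finally show ?thesis .
  qed
  show "inner u v = inner v u" by (simp add: inner_beam_eq mult.commute)
  show "inner (u + v) w = inner u w + inner v w"
    using lin[of 1 1] by (simp add: inner_beam.rep_eq plus_beam.rep_eq)
  show "inner (a *\<^sub>R u) w = a * inner u w"
    using lin[of a 0] by (simp add: inner_beam.rep_eq scaleR_beam.rep_eq)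
  show "0 \<le> inner u u" by (simp add: inner_beam_eq)
  show "(inner u u = 0) = (u = 0)"
  proof
    assume "inner u u = 0"
    then have "deflection u = (\<lambda>_. 0)"
      unfolding deflection_eq by (intro double_primitive_eq_zero curvature_L2) (simp add: inner_beam_eq)
    then show "u = 0" by (simp add: deflection_inject[symmetric] zero_beam.rep_eq)
  next
    assume "u = 0"
    then have "deflection u = double_primitive (\<lambda>_. 0)" by (simp add: zero_beam.rep_eq double_primitive_def fun_eq_iff)
    then have "inner u u = X_inner (double_primitive (\<lambda>_. 0)) (double_primitive (\<lambda>_. 0))"
      by (simp add: inner_beam.rep_eq)
    also have "\<dots> = 0" by (subst X_inner_double_primitive) (auto simp: L2_def)
    finally show "inner u u = 0" .
  qed
  show "norm u = sqrt (inner u u)"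
    by (simp add: norm_beam.rep_eq inner_beam.rep_eq X_norm_def)
  show "u + v + w = u + (v + w)" by transfer (simp add: add.assoc)
  show "u + v = v + u" by transfer (simp add: add.commute)
  show "0 + u = u" by transfer simp
  show "- u + u = 0" by transfer simp
  show "u - v = u + - v" by transfer simp
  fix b :: real
  show "a *\<^sub>R (u + v) = a *\<^sub>R u + a *\<^sub>R v" by transfer (simp add: algebra_simps)
  show "(a + b) *\<^sub>R u = a *\<^sub>R u + b *\<^sub>R u" by transfer (simp add: algebra_simps)
  show "a *\<^sub>R b *\<^sub>R u = (a * b) *\<^sub>R u" by transfer (simp add: algebra_simps)
  show "1 *\<^sub>R u = u" by transfer simp
  show "dist u v = norm (u - v)" by (rule dist_beam_def)
  show "sgn u = scaleR (inverse (norm u)) u" by (rule sgn_beam_def)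
  show "uniformity = (INF e\<in>{0 <..}. principal {(u::beam, v). dist u v < e})" by (rule uniformity_beam_def)
  show "open U = (\<forall>u\<in>U. \<forall>\<^sub>F (u', v) in uniformity. u' = u \<longrightarrow> v \<in> U)" for U :: "beam set"
    by (rule open_beam_def)
qed

end

section \<open>Pointwise bounds in terms of the norm\<close>

lemma integrable_curvature: "integrable \<mu> (curvature u)"
  by (rule L2_integrable[OF curvature_L2])

definition slope :: "beam \<Rightarrow> real \<Rightarrow> real" where
  "slope u t = integral {0..t} (curvature u)"

lemma continuous_slope: "continuous_on {0..1} (slope u)"
  unfolding slope_def by (rule continuous_on_integral_mu[OF integrable_curvature])

lemma deflection_eq_integral_slope:
  "t \<in> {0..1} \<Longrightarrow> deflection u t = integral {0..t} (slope u)"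
  by (subst deflection_eq) (simp add: double_primitive_def slope_def[abs_def])

lemma deflection_deriv:
  "t \<in> {0..1} \<Longrightarrow> (deflection u has_real_derivative slope u t) (at t within {0..1})"
  unfolding slope_def by (subst deflection_eq) (rule double_primitive_deriv[OF integrable_curvature])

lemma continuous_deflection: "continuous_on {0..1} (deflection u)"
  by (rule DERIV_continuous_on, rule deflection_deriv)

lemma inner_Beam_double_primitive:
  assumes "g \<in> L2"
  shows "inner (Beam (double_primitive g)) u = (LINT t|\<mu>. g t * curvature u t)"
  using X_inner_double_primitive[OF assms curvature_L2, of u]
  by (simp add: inner_beam.rep_eq deflection_Beam_double_primitive assms deflection_eq[symmetric])

text \<open>Evaluation of \<open>u'\<close> at \<open>t\<close> is the pairing with the element
  whose second derivative is the indicator of [0,t]; its norm is \<open>sqrt t\<close>, and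
  Cauchy-Schwarz finishes.\<close>

lemma slope_bound:
  assumes t: "t \<in> {0..1}"
  shows "\<bar>slope u t\<bar> \<le> sqrt t * norm u"
proof -
  let ?g = "\<lambda>s. 1 * indicator {..t} s :: real"
  define w where "w = Beam (double_primitive ?g)"
  have ig: "integrable \<mu> ?g" by (rule integral_mu_cut(1)) auto
  have "(\<lambda>s. (?g s)\<^sup>2) = ?g" by (auto simp: indicator_def)
  with ig have g: "?g \<in> L2" unfolding L2_def by (simp only: mem_Collect_eq borel_measurable_integrable)
  have gg: "(LINT s|\<mu>. ?g s * ?g s) = t"
  proof -
    have "(LINT s|\<mu>. ?g s * ?g s) = (LINT s|\<mu>. ?g s)"
      by (rule Bochner_Integration.integral_cong) (auto simp: indicator_def)
    also have "\<dots> = integral {0..t} (\<lambda>_. 1)"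
      by (rule integral_initial_segment[symmetric]) (use t in auto)
    finally show ?thesis using t by simp
  qed
  have "(norm w)\<^sup>2 = X_inner (double_primitive ?g) (double_primitive ?g)"
    unfolding w_def power2_norm_eq_inner inner_beam.rep_eq deflection_Beam_double_primitive[OF g] ..
  also have "\<dots> = t" unfolding X_inner_double_primitive[OF g g] by (rule gg)
  finally have "norm w = sqrt t" by (metis norm_ge_zero real_sqrt_abs abs_of_nonneg)
  moreover have "slope u t = inner w u"
    unfolding w_def slope_def inner_Beam_double_primitive[OF g]
      integral_initial_segment[OF integrable_curvature t] by (simp add: mult.commute)
  ultimately show ?thesis using Cauchy_Schwarz_ineq2[of w u] by simp
qed

lemma has_integral_sqrt:
  assumes "t \<ge> 0" shows "(sqrt has_integral 2 / 3 * t powr (3 / 2)) {0..t}"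
proof -
  have "((\<lambda>s. s powr (1 / 2)) has_integral t powr (1 / 2 + 1) / (1 / 2 + 1)) {0..t}"
    by (rule has_integral_powr_from_0) (use assms in auto)
  then have "((\<lambda>s. s powr (1 / 2)) has_integral 2 / 3 * t powr (3 / 2)) {0..t}" by (simp add: mult.commute)
  then show ?thesis
    by (rule has_integral_eq[rotated]) (simp add: powr_half_sqrt)
qed

lemma deflection_bound:
  assumes t: "t \<in> {0..1}"
  shows "\<bar>deflection u t\<bar> \<le> 2 / 3 * t powr (3 / 2) * norm u"
proof -
  have s: "((\<lambda>s. sqrt s * norm u) has_integral 2 / 3 * t powr (3 / 2) * norm u) {0..t}"
    using t by (intro has_integral_mult_left has_integral_sqrt) auto
  have "norm (integral {0..t} (slope u)) \<le> integral {0..t} (\<lambda>s. sqrt s * norm u)"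
  proof (rule integral_norm_bound_integral)
    show "slope u integrable_on {0..t}"
      using t by (intro integrable_continuous_real continuous_on_subset[OF continuous_slope]) auto
    show "norm (slope u s) \<le> sqrt s * norm u" if "s \<in> {0..t}" for s
      using slope_bound[of s u] that t by auto
  qed (use s in blast)
  then show ?thesis unfolding integral_unique[OF s] using t by (simp add: deflection_eq_integral_slope)
qed

text \<open>The source of the argument \<open>2/3 * R1\<close> in the upper growth
  condition.\<close>

lemma deflection_le: "t \<in> {0..1} \<Longrightarrow> \<bar>deflection u t\<bar> \<le> 2 / 3 * norm u"
  using deflection_bound[of t u] mult_right_mono[of "t powr (3 / 2)" 1 "2 / 3 * norm u"]
  by (auto simp: powr_le1 ac_simps)

lemma deflection_le_norm: "t \<in> {0..1} \<Longrightarrow> \<bar>deflection u t\<bar> \<le> norm u"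
  using deflection_le[of t u] norm_ge_zero[of u] by linarith

text \<open>Integrating \<open>2/3 * t powr (3/2)\<close> gives 2/3 times 2/5, that is 4/15; its
  reciprocal is the constant of the upper growth condition.\<close>

lemma integral_deflection_le: "integral {0..1} (deflection u) \<le> 4 / 15 * norm u"
proof -
  have "((\<lambda>t. t powr (3 / 2)) has_integral 1 powr (3 / 2 + 1) / (3 / 2 + 1)) {0..1::real}"
    by (rule has_integral_powr_from_0) auto
  then have i: "((\<lambda>t. 2 / 3 * t powr (3 / 2) * norm u) has_integral 2 / 3 * (2 / 5) * norm u) {0..1}"
    by (intro has_integral_mult_left has_integral_mult_right) simp
  have "integral {0..1} (deflection u) \<le> integral {0..1} (\<lambda>t. 2 / 3 * t powr (3 / 2) * norm u)"
  proof (rule integral_le)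
    show "deflection u t \<le> 2 / 3 * t powr (3 / 2) * norm u" if "t \<in> {0..1}" for t
      using deflection_bound[OF that, of u] by linarith
  qed (use i integrable_continuous_real[OF continuous_deflection] in auto)
  then show ?thesis unfolding integral_unique[OF i] by simp
qed

text \<open>Supplies the equicontinuity for Arzela-Ascoli, uniformly on bounded sets.\<close>

lemma deflection_Lipschitz:
  assumes "s \<in> {0..1}" "t \<in> {0..1}"
  shows "\<bar>deflection u s - deflection u t\<bar> \<le> norm u * \<bar>s - t\<bar>"
proof -
  have "norm (deflection u s - deflection u t) \<le> norm u * norm (s - t)"
  proof (rule field_differentiable_bound[of "{0..1}"])
    fix z :: real assume z: "z \<in> {0..1}"
    show "(deflection u has_field_derivative slope u z) (at z within {0..1})"
      by (rule deflection_deriv[OF z])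
    have "sqrt z * norm u \<le> 1 * norm u" using z by (intro mult_right_mono) auto
    then show "norm (slope u z) \<le> norm u" using slope_bound[OF z, of u] by simp
  qed (use assms in auto)
  then show ?thesis by simp
qed

section \<open>The linear problem\<close>

definition tail :: "(real \<Rightarrow> real) \<Rightarrow> real \<Rightarrow> real" where
  "tail h t = integral {t..1} h"

lemma tail_deriv:
  assumes "continuous_on {0..1} h" "t \<in> {0..1}"
  shows "(tail h has_real_derivative - h t) (at t within {0..1})"
  unfolding tail_def by (rule integral_has_real_derivative'[OF assms])

lemma continuous_tail: "continuous_on {0..1} h \<Longrightarrow> continuous_on {0..1} (tail h)"
  by (rule DERIV_continuous_on, rule tail_deriv)

text \<open>For the solution \<open>w\<close> of \<open>w'''' = h\<close>, this is
  \<open>w''\<close>, and \<open>tail h\<close> is \<open>-w'''\<close>. Integrating from the right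
  end builds in the conditions at 1.\<close>

definition moment :: "(real \<Rightarrow> real) \<Rightarrow> real \<Rightarrow> real" where "moment h = tail (tail h)"

lemma continuous_moment: "continuous_on {0..1} h \<Longrightarrow> continuous_on {0..1} (moment h)"
  unfolding moment_def by (intro continuous_tail)

text \<open>\<open>load h\<close> is the solution of \<open>w'''' = h\<close> under the boundary conditions of (P).\<close>

definition load :: "(real \<Rightarrow> real) \<Rightarrow> beam" where
  "load h = Beam (double_primitive (moment h))"

lemma deflection_load:
  "continuous_on {0..1} h \<Longrightarrow> deflection (load h) = double_primitive (moment h)"
  unfolding load_def by (intro deflection_Beam_double_primitive L2_of_continuous continuous_moment)

text \<open>The triangle identity, used twice, moves the two integrations from \<open>h\<close> onto
  the curvature. Thus \<open>load h\<close> is the Riesz representative of integration against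
  \<open>h\<close>.\<close>

lemma inner_load:
  assumes h: "continuous_on {0..1} h"
  shows "inner (load h) u = integral {0..1} (\<lambda>t. h t * deflection u t)"
proof -
  have "inner (load h) u = (LINT t|\<mu>. curvature u t * integral {t..1} (tail h))"
    unfolding load_def inner_Beam_double_primitive[OF L2_of_continuous[OF continuous_moment[OF h]]]
    by (simp add: moment_def tail_def[of "tail h"] mult.commute)
  also have "\<dots> = (LINT t|\<mu>. tail h t * slope u t)"
    unfolding slope_def by (rule integral_mu_triangle[OF integrable_curvature continuous_tail[OF h], symmetric])
  also have "\<dots> = (LINT t|\<mu>. slope u t * integral {t..1} h)"
    by (simp add: tail_def mult.commute)
  also have "\<dots> = (LINT t|\<mu>. h t * integral {0..t} (slope u))"
    by (rule integral_mu_triangle[OF integrable_mu_of_continuous[OF continuous_slope] h, symmetric])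
  also have "\<dots> = (LINT t|\<mu>. h t * deflection u t)"
    by (rule Bochner_Integration.integral_cong) (auto simp: deflection_eq_integral_slope)
  also have "\<dots> = integral {0..1} (\<lambda>t. h t * deflection u t)"
    by (intro integral_mu_eq integrable_mu_of_continuous continuous_intros h continuous_deflection)
  finally show ?thesis .
qed

text \<open>The difference \<open>v\<close> of the two loads is tested against itself;
  \<open>|v(t)| <= |v|\<close> then allows one factor \<open>|v|\<close> to be cancelled.\<close>

lemma norm_load_diff_le:
  assumes h: "continuous_on {0..1} h" and k: "continuous_on {0..1} k"
    and B: "\<And>t. t \<in> {0..1} \<Longrightarrow> \<bar>h t - k t\<bar> \<le> B"
  shows "norm (load h - load k) \<le> B"
proof -
  let ?v = "load h - load k"
  have "B \<ge> 0" using B[of 0] by simp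
  have i: "(\<lambda>t. h t * deflection ?v t) integrable_on {0..1}" "(\<lambda>t. k t * deflection ?v t) integrable_on {0..1}"
    by (intro integrable_continuous_real continuous_intros h k continuous_deflection)+
  have "norm ?v * norm ?v = inner (load h) ?v - inner (load k) ?v"
    by (simp add: inner_diff_left[symmetric] power2_norm_eq_inner[symmetric] power2_eq_square)
  also have "\<dots> = integral {0..1} (\<lambda>t. (h t - k t) * deflection ?v t)"
    unfolding inner_load[OF h] inner_load[OF k] using i
    by (simp add: left_diff_distrib Henstock_Kurzweil_Integration.integral_diff)
  also have "\<dots> \<le> integral {0..1} (\<lambda>t::real. B * norm ?v)"
  proof (rule integral_le)
    show "(\<lambda>t. (h t - k t) * deflection ?v t) integrable_on {0..1}"
      by (intro integrable_continuous_real continuous_intros h k continuous_deflection)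
    fix t :: real assume t: "t \<in> {0..1}"
    have "(h t - k t) * deflection ?v t \<le> \<bar>h t - k t\<bar> * \<bar>deflection ?v t\<bar>"
      by (metis abs_ge_self abs_mult)
    also have "\<dots> \<le> B * norm ?v"
      using B[OF t] deflection_le_norm[OF t] \<open>B \<ge> 0\<close> by (intro mult_mono) auto
    finally show "(h t - k t) * deflection ?v t \<le> B * norm ?v" .
  qed (rule integrable_continuous_real[OF continuous_on_const])
  finally have "norm ?v * norm ?v \<le> B * norm ?v" by simp
  then show ?thesis using \<open>B \<ge> 0\<close> by (cases "norm ?v = 0") (auto simp: mult_le_cancel_right)
qed

lemma load_is_solution:
  assumes h: "continuous_on {0..1} h" and eq: "\<And>t. t \<in> {0..1} \<Longrightarrow> h t = f (deflection (load h) t)"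
  shows "is_solution f (deflection (load h))"
proof -
  let ?u = "deflection (load h)"
  note cm = continuous_moment[OF h] and ct = continuous_tail[OF h]
  show ?thesis
    unfolding is_solution_def
  proof (rule exI[of _ "\<lambda>t. integral {0..t} (moment h)"], rule exI[of _ "moment h"],
      rule exI[of _ "\<lambda>t. - tail h t"], rule exI[of _ h], intro conjI ballI)
    fix t :: real assume t: "t \<in> {0..1}"
    show "(?u has_real_derivative integral {0..t} (moment h)) (at t within {0..1})"
      unfolding deflection_load[OF h]
      by (rule double_primitive_deriv[OF integrable_mu_of_continuous[OF cm] t])
    show "((\<lambda>t. integral {0..t} (moment h)) has_real_derivative moment h t) (at t within {0..1})"
      by (rule integral_has_real_derivative[OF cm t])
    show "(moment h has_real_derivative - tail h t) (at t within {0..1})"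
      unfolding moment_def by (rule tail_deriv[OF ct t])
    show "((\<lambda>t. - tail h t) has_real_derivative h t) (at t within {0..1})"
      using DERIV_minus[OF tail_deriv[OF h t]] by simp
  qed (use h eq in \<open>auto simp: deflection_load double_primitive_def moment_def tail_def\<close>)
qed

text \<open>The substitution \<open>r \<mapsto> t + (1 - t) * r\<close> carries [s,1] onto the
  domain of the right-hand tail and contributes a factor \<open>1 - t\<close>. The constant
  \<open>c\<close> is there so that the conclusion can serve again as hypothesis for the next
  tail.\<close>

lemma tail_rescale:
  assumes h: "continuous_on {0..1} h" and k: "continuous_on {0..1} k"
    and t: "t \<in> {0..1}" and s: "s \<in> {0..1}"
    and le: "\<And>r. r \<in> {0..1} \<Longrightarrow> c * h r \<le> k (t + (1 - t) * r)"
  shows "(1 - t) * c * tail h s \<le> tail k (t + (1 - t) * s)"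
proof -
  have sub: "t + (1 - t) * r \<in> {0..1}" if "r \<in> {0..1}" for r
    using convex_bound_le[of 1 1 r t "1 - t"] that t by (auto simp: mult.commute)
  have "((\<lambda>r. (1 - t) *\<^sub>R k (t + (1 - t) * r)) has_integral
      integral {t + (1 - t) * s..t + (1 - t) * 1} k) {s..1}"
  proof (rule has_integral_substitution)
    show "(\<lambda>r. t + (1 - t) * r) ` {s..1} \<subseteq> {0..1}" using sub s by force
    show "((\<lambda>r. t + (1 - t) * r) has_real_derivative 1 - t) (at x within {s..1})" for x
      by (auto intro!: derivative_eq_intros)
    show "t + (1 - t) * s \<le> t + (1 - t) * 1" using s t by (intro add_left_mono mult_left_mono) auto
  qed (use s k in auto)
  then have i: "((\<lambda>r. (1 - t) * k (t + (1 - t) * r)) has_integral tail k (t + (1 - t) * s)) {s..1}"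
    by (simp add: tail_def)
  have "h integrable_on {s..1}"
    using s by (intro integrable_continuous_real continuous_on_subset[OF h]) auto
  then have "((\<lambda>r. (1 - t) * c * h r) has_integral (1 - t) * c * tail h s) {s..1}"
    unfolding tail_def by (intro has_integral_mult_right integrable_integral)
  then show ?thesis
  proof (rule has_integral_le[OF _ i])
    fix r assume "r \<in> {s..1}"
    then show "(1 - t) * c * h r \<le> (1 - t) * k (t + (1 - t) * r)"
      using le[of r] s t mult_left_mono[of "c * h r" "k (t + (1 - t) * r)" "1 - t"] by (simp add: mult.assoc)
  qed
qed

lemma tail_antimono:
  assumes h: "continuous_on {0..1} h" and pos: "\<And>t. t \<in> {0..1} \<Longrightarrow> 0 \<le> h t"
    and "0 \<le> s" "s \<le> t" "t \<le> 1"
  shows "tail h t \<le> tail h s" "0 \<le> tail h t"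
  unfolding tail_def using assms
  by (auto intro!: integral_subset_le integral_nonneg integrable_continuous_real continuous_on_subset[OF h])

text \<open>Mean values on both sides of the intermediate point compare the two difference
  quotients. Derivatives relative to [0,1] suffice, so the end points are covered.\<close>

lemma convex_on_of_mono_deriv:
  fixes u :: "real \<Rightarrow> real"
  assumes D: "\<And>t. t \<in> {0..1} \<Longrightarrow> (u has_real_derivative u' t) (at t within {0..1})"
    and mono: "mono_on {0..1} u'"
  shows "convex_on {0..1} u"
proof (rule convex_on_linorderI)
  fix t x y :: real
  assume t: "0 < t" "t < 1" and x: "x \<in> {0..1}" and y: "y \<in> {0..1}" and xy: "x < y"
  define z where "z = (1 - t) * x + t * y"
  have zx: "z - x = t * (y - x)" and yz: "y - z = (1 - t) * (y - x)"
    by (auto simp: z_def algebra_simps)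
  have "x < z" "z < y" using t xy zx yz by (metis diff_gt_0_iff_gt mult_pos_pos)+
  have mean: "\<exists>\<xi>\<in>{p<..<q}. u q - u p = u' \<xi> * (q - p)" if "p < q" "0 \<le> p" "q \<le> 1" for p q
  proof (rule mvt_simple[OF \<open>p < q\<close>])
    fix r assume "p \<le> r" "r \<le> q"
    then show "(u has_derivative (*) (u' r)) (at r within {p..q})"
      using has_field_derivative_subset[OF D[of r], of "{p..q}"] that by (auto simp: has_field_derivative_def)
  qed
  obtain \<xi> where \<xi>: "\<xi> \<in> {x<..<z}" "u z - u x = u' \<xi> * (z - x)"
    using mean[of x z] \<open>x < z\<close> \<open>z < y\<close> x y by auto
  obtain \<eta> where \<eta>: "\<eta> \<in> {z<..<y}" "u y - u z = u' \<eta> * (y - z)"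
    using mean[of z y] \<open>x < z\<close> \<open>z < y\<close> x y by auto
  have "u' \<xi> \<le> u' \<eta>" using \<xi> \<eta> x y by (intro mono_onD[OF mono]) auto
  then have "(t * (1 - t) * (y - x)) * u' \<xi> \<le> (t * (1 - t) * (y - x)) * u' \<eta>"
    using t xy by (intro mult_left_mono) auto
  then have "(1 - t) * (u z - u x) \<le> t * (u y - u z)"
    unfolding \<xi> \<eta> zx yz by (simp add: mult_ac)
  then show "u ((1 - t) *\<^sub>R x + t *\<^sub>R y) \<le> (1 - t) * u x + t * u y"
    by (simp add: z_def algebra_simps)
qed simp

text \<open>The factor 1/4 is what double integration yields for loads in
  \<open>load_in_cone\<close>; it majorizes \<open>M0\<close> since \<open>sqrt 2 <= 3/2\<close> and
  \<open>(1 - t) * t <= 1\<close>.\<close>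

lemma M0_bounds: "t \<in> {0..1} \<Longrightarrow> 0 \<le> M0 t" "t \<in> {0..1} \<Longrightarrow> M0 t \<le> t\<^sup>2 / 4"
proof -
  assume t: "t \<in> {0..1}"
  then show "0 \<le> M0 t" by (simp add: M0_def)
  have "sqrt 2 \<le> 3 / 2" by (rule real_le_lsqrt) (auto simp: power2_eq_square)
  moreover have "(1 - t) * t \<le> 1" using t by (intro mult_le_one) auto
  ultimately have "sqrt 2 * ((1 - t) * t) \<le> 3 / 2 * 1" using t by (intro mult_mono) auto
  then have "sqrt 2 * ((1 - t) * t) * t\<^sup>2 / 6 \<le> 3 / 2 * 1 * t\<^sup>2 / 6"
    by (intro divide_right_mono mult_right_mono) auto
  then show "M0 t \<le> t\<^sup>2 / 4" by (simp add: M0_def power3_eq_cube power2_eq_square mult_ac)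
qed

text \<open>Since \<open>h\<close> is nondecreasing, contracting \<open>[0,1]\<close> onto \<open>[t,1]\<close> does not decrease \<open>h\<close>, so that two
  integrations give \<open>w''(t) \<ge> (1 - t)\<^sup>2 w''(0)\<close>, while \<open>|w| \<le> w''(0)\<close>.\<close>

lemma load_in_cone:
  assumes h: "continuous_on {0..1} h" and pos: "\<And>t. t \<in> {0..1} \<Longrightarrow> 0 \<le> h t"
    and mono: "mono_on {0..1} h"
  shows "deflection (load h) \<in> K_cone"
proof -
  let ?g = "moment h"
  \<comment> \<open>This is \<open>w''(0)\<close>, the maximum of \<open>w''\<close>, and hence also
    a bound for the norm of \<open>w\<close>.\<close>
  define c where "c = ?g 0"
  note ct = continuous_tail[OF h] and cm = continuous_moment[OF h]
  have im: "?g integrable_on {0..t}" if "t \<in> {0..1}" for t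
    using that by (intro integrable_continuous_real continuous_on_subset[OF cm]) auto
  have tpos: "0 \<le> tail h t" if "t \<in> {0..1}" for t
    using tail_antimono(2)[OF h pos] that by auto
  have g: "0 \<le> ?g t" "?g t \<le> c" if "t \<in> {0..1}" for t
    using tail_antimono[OF ct tpos, of 0 t] that by (auto simp: moment_def c_def)
  have "c \<ge> 0" using g(1)[of 0] by (simp add: c_def)
  have lower: "(1 - t)\<^sup>2 * c \<le> ?g t" if t: "t \<in> {0..1}" for t
  proof -
    have "(1 - t) * tail h s \<le> tail h (t + (1 - t) * s)" if s: "s \<in> {0..1}" for s
    proof -
      have "1 * h r \<le> h (t + (1 - t) * r)" if r: "r \<in> {0..1}" for r
      proof -
        have "0 \<le> t * (1 - r)" "0 \<le> (1 - t) * (1 - r)" using t r by auto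
        then have "r \<le> t + (1 - t) * r" "t + (1 - t) * r \<le> 1" by (auto simp: algebra_simps)
        then show ?thesis using r by (auto intro!: mono_onD[OF mono])
      qed
      then show ?thesis using tail_rescale[OF h h t s, of 1] by simp
    qed
    \<comment> \<open>Second use of \<open>tail_rescale\<close>; the factor \<open>1 - t\<close>
      gained from the first use is now its \<open>c\<close>.\<close>
    then have "(1 - t) * (1 - t) * tail (tail h) 0 \<le> tail (tail h) (t + (1 - t) * 0)"
      by (intro tail_rescale ct t) auto
    then show ?thesis by (simp add: c_def moment_def power2_eq_square)
  qed
  have slope_lower: "c * (1 - (1 - s) ^ 3) / 3 \<le> integral {0..s} ?g" if s: "s \<in> {0..1}" for s
  proof -
    have "((\<lambda>t. (1 - t)\<^sup>2 * c) has_integral (- c * (1 - s) ^ 3 / 3 - (- c * (1 - 0) ^ 3 / 3))) {0..s}"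
      using s by (intro fundamental_theorem_of_calculus)
        (auto simp: has_real_derivative_iff_has_vector_derivative[symmetric] intro!: derivative_eq_intros)
    then have "- c * (1 - s) ^ 3 / 3 - (- c * (1 - 0) ^ 3 / 3) \<le> integral {0..s} ?g"
      by (rule has_integral_le[OF _ integrable_integral[OF im[OF s]]]) (use lower s in auto)
    then show ?thesis by (simp add: field_simps)
  qed
  have cG: "continuous_on {0..1} (\<lambda>s. integral {0..s} ?g)"
    by (rule continuous_on_integral_mu[OF integrable_mu_of_continuous[OF cm]])
  have val: "t\<^sup>2 / 4 * c \<le> deflection (load h) t" if t: "t \<in> {0..1}" for t
  proof -
    have "((\<lambda>s. c * (1 - (1 - s) ^ 3) / 3) has_integral
        (c * (t + (1 - t) ^ 4 / 4) / 3 - c * (0 + (1 - 0) ^ 4 / 4) / 3)) {0..t}"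
      using t by (intro fundamental_theorem_of_calculus)
        (auto simp: has_real_derivative_iff_has_vector_derivative[symmetric] intro!: derivative_eq_intros)
    moreover have "((\<lambda>s. integral {0..s} ?g) has_integral deflection (load h) t) {0..t}"
      unfolding deflection_load[OF h] double_primitive_def using t
      by (auto intro!: integrable_integral integrable_continuous_real continuous_on_subset[OF cG])
    ultimately have *: "c * (t + (1 - t) ^ 4 / 4) / 3 - c * (0 + (1 - 0) ^ 4 / 4) / 3 \<le> deflection (load h) t"
      by (rule has_integral_le) (use slope_lower t in auto)
    \<comment> \<open>The excess of the twice integrated lower bound over
      \<open>t^2 / 4 * c\<close>, in factored form.\<close>
    have "0 \<le> c / 12 * (t\<^sup>2 * ((1 - t) * (3 - t)))" using t \<open>c \<ge> 0\<close> by auto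
    also have "\<dots> = c * (t + (1 - t) ^ 4 / 4) / 3 - c * (0 + (1 - 0) ^ 4 / 4) / 3 - t\<^sup>2 / 4 * c"
      by (simp add: field_simps power2_eq_square power4_eq_xxxx)
    finally show ?thesis using * by linarith
  qed
  have "(norm (load h))\<^sup>2 = X_inner (double_primitive ?g) (double_primitive ?g)"
    unfolding power2_norm_eq_inner inner_beam.rep_eq deflection_load[OF h] ..
  also have "\<dots> = (LINT t|\<mu>. ?g t * ?g t)"
    by (intro X_inner_double_primitive L2_of_continuous cm)
  also have "\<dots> \<le> (LINT t|\<mu>. c * c)"
    by (rule integral_mono) (auto intro!: integrable_mu_of_continuous continuous_intros cm mult_mono g \<open>c \<ge> 0\<close>)
  finally have "(norm (load h))\<^sup>2 \<le> c\<^sup>2"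
    unfolding integral_mu_const by (simp add: power2_eq_square)
  then have norm_le: "norm (load h) \<le> c"
    using \<open>c \<ge> 0\<close> by (rule power2_le_imp_le)
  have "M0 t * norm (load h) \<le> deflection (load h) t" if t: "t \<in> {0..1}" for t
  proof -
    have "M0 t * norm (load h) \<le> t\<^sup>2 / 4 * c"
      using M0_bounds[OF t] norm_le by (intro mult_mono) auto
    then show ?thesis using val[OF t] by linarith
  qed
  moreover have "convex_on {0..1} (deflection (load h))"
  proof (rule convex_on_of_mono_deriv)
    show "(deflection (load h) has_real_derivative integral {0..t} ?g) (at t within {0..1})" if "t \<in> {0..1}" for t
      unfolding deflection_load[OF h] by (rule double_primitive_deriv[OF integrable_mu_of_continuous[OF cm] that])
    show "mono_on {0..1} (\<lambda>t. integral {0..t} ?g)"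
      by (rule mono_onI) (use g in \<open>auto intro!: integral_subset_le im\<close>)
  qed
  ultimately show ?thesis
    by (simp add: K_cone_def deflection norm_beam.rep_eq)
qed

section \<open>The cone and the energy\<close>

definition beam_cone :: "beam set" where "beam_cone = {u. deflection u \<in> K_cone}"

lemma cone_iff:
  "u \<in> beam_cone \<longleftrightarrow> convex_on {0..1} (deflection u) \<and> (\<forall>t\<in>{0..1}. M0 t * norm u \<le> deflection u t)"
  by (simp add: beam_cone_def K_cone_def deflection norm_beam.rep_eq)

lemma deflection_zero_left: "deflection u 0 = 0"
  by (simp add: deflection_eq_integral_slope)

lemma deflection_nonneg:
  assumes "u \<in> beam_cone" "t \<in> {0..1}" shows "0 \<le> deflection u t"
proof -
  have "0 \<le> M0 t * norm u" using M0_bounds(1)[OF assms(2)] by simp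
  also have "\<dots> \<le> deflection u t" using assms by (simp add: cone_iff)
  finally show ?thesis .
qed

text \<open>For \<open>s = l * t\<close>, convexity and the value 0 at 0 give
  \<open>u(s) <= l * u(t)\<close>, and nonnegativity of \<open>u(t)\<close> allows \<open>l\<close>
  to be dropped.\<close>

lemma deflection_mono:
  assumes u: "u \<in> beam_cone" shows "mono_on {0..1} (deflection u)"
proof (rule mono_onI)
  fix s t :: real assume s: "s \<in> {0..1}" and t: "t \<in> {0..1}" and "s \<le> t"
  show "deflection u s \<le> deflection u t"
  proof (cases "t = 0")
    case True then show ?thesis using \<open>s \<le> t\<close> s by auto
  next
    case False
    define l where "l = s / t"
    have l: "0 \<le> l" "l \<le> 1" "s = l * t" using False s t \<open>s \<le> t\<close> by (auto simp: l_def)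
    have "deflection u ((1 - l) *\<^sub>R 0 + l *\<^sub>R t) \<le> (1 - l) * deflection u 0 + l * deflection u t"
      using u l t by (intro convex_onD) (auto simp: cone_iff)
    then have "deflection u s \<le> l * deflection u t" using l by (simp add: deflection_zero_left)
    also have "\<dots> \<le> deflection u t"
      using l deflection_nonneg[OF u t] by (simp add: mult_left_le_one_le)
    finally show ?thesis .
  qed
qed

lemma cone_add: "u \<in> beam_cone \<Longrightarrow> v \<in> beam_cone \<Longrightarrow> u + v \<in> beam_cone"
proof -
  assume u: "u \<in> beam_cone" and v: "v \<in> beam_cone"
  have "M0 t * norm (u + v) \<le> deflection (u + v) t" if t: "t \<in> {0..1}" for t
  proof -
    have "M0 t * norm (u + v) \<le> M0 t * norm u + M0 t * norm v"
      unfolding distrib_left[symmetric] by (intro mult_left_mono norm_triangle_ineq M0_bounds t)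
    also have "\<dots> \<le> deflection u t + deflection v t"
      using u v t by (intro add_mono) (auto simp: cone_iff)
    finally show ?thesis by (simp add: plus_beam.rep_eq)
  qed
  then show ?thesis
    using u v by (auto simp: cone_iff plus_beam.rep_eq intro: convex_on_add)
qed

lemma cone_scaleR: "u \<in> beam_cone \<Longrightarrow> 0 \<le> c \<Longrightarrow> c *\<^sub>R u \<in> beam_cone"
  by (auto simp: cone_iff scaleR_beam.rep_eq mult.left_commute[of _ c] intro: convex_on_cmul mult_left_mono)

lemma cone_segment:
  assumes "u \<in> beam_cone" "v \<in> beam_cone" "0 \<le> s" "s \<le> 1"
  shows "u + s *\<^sub>R (v - u) \<in> beam_cone"
proof -
  have "u + s *\<^sub>R (v - u) = (1 - s) *\<^sub>R u + s *\<^sub>R v" by (simp add: algebra_simps)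
  then show ?thesis using assms by (simp add: cone_add cone_scaleR)
qed

lemma tendsto_deflection:
  assumes "(u \<longlongrightarrow> l) F" "t \<in> {0..1}"
  shows "((\<lambda>n. deflection (u n) t) \<longlongrightarrow> deflection l t) F"
proof (rule LIM_zero_cancel, rule Lim_null_comparison)
  show "\<forall>\<^sub>F n in F. norm (deflection (u n) t - deflection l t) \<le> norm (u n - l)"
    using deflection_le_norm[OF assms(2), of "_ - l"] by (auto simp: minus_beam.rep_eq)
  show "((\<lambda>n. norm (u n - l)) \<longlongrightarrow> 0) F"
    using assms(1) by (simp add: LIM_zero tendsto_norm_zero)
qed

text \<open>All conditions are inequalities between point values and norms, and norm convergence
  implies pointwise convergence.\<close>

lemma closed_cone: "closed beam_cone"
  unfolding closed_sequential_limits
proof (intro allI impI, elim conjE)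
  fix u l assume u: "\<forall>n. u n \<in> beam_cone" and l: "u \<longlonglongrightarrow> l"
  have "convex_on {0..1} (deflection l)"
  proof (rule convex_onI)
    fix s x y :: real assume s: "0 < s" "s < 1" and x: "x \<in> {0..1}" and y: "y \<in> {0..1}"
    have z: "(1 - s) *\<^sub>R x + s *\<^sub>R y \<in> {0..1}"
      using convexD[OF convex_closed_interval[of 0 "1::real"] x y, of "1 - s" s] s by simp
    show "deflection l ((1 - s) *\<^sub>R x + s *\<^sub>R y) \<le> (1 - s) * deflection l x + s * deflection l y"
    proof (rule LIMSEQ_le)
      show "(\<lambda>n. deflection (u n) ((1 - s) *\<^sub>R x + s *\<^sub>R y)) \<longlonglongrightarrow> deflection l ((1 - s) *\<^sub>R x + s *\<^sub>R y)"
        by (rule tendsto_deflection[OF l z])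
      show "(\<lambda>n. (1 - s) * deflection (u n) x + s * deflection (u n) y) \<longlonglongrightarrow>
          (1 - s) * deflection l x + s * deflection l y"
        by (intro tendsto_intros tendsto_deflection[OF l] x y)
      show "\<exists>N. \<forall>n\<ge>N. deflection (u n) ((1 - s) *\<^sub>R x + s *\<^sub>R y) \<le>
          (1 - s) * deflection (u n) x + s * deflection (u n) y"
        using u s x y convex_onD[of "{0..1}" "deflection (u _)" s x y] by (auto simp: cone_iff)
    qed
  qed simp
  moreover have "M0 t * norm l \<le> deflection l t" if t: "t \<in> {0..1}" for t
  proof (rule LIMSEQ_le)
    show "(\<lambda>n. M0 t * norm (u n)) \<longlonglongrightarrow> M0 t * norm l" by (intro tendsto_intros l)
    show "(\<lambda>n. deflection (u n) t) \<longlonglongrightarrow> deflection l t" by (rule tendsto_deflection[OF l t])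
    show "\<exists>N. \<forall>n\<ge>N. M0 t * norm (u n) \<le> deflection (u n) t" using u t by (auto simp: cone_iff)
  qed
  ultimately show "l \<in> beam_cone" by (simp add: cone_iff)
qed

text \<open>The parabola \<open>t^2 / 2\<close> has second derivative 1 and so norm 1. Its multiple
  by \<open>R0\<close> will show that the shell is nonempty, without which the infimum of the energy
  would say nothing.\<close>

lemma cone_unit_element:
  obtains e where "e \<in> beam_cone" "norm e = 1"
proof -
  have one: "(\<lambda>_. 1) \<in> L2" by (rule L2_of_continuous) simp
  define e where "e = Beam (double_primitive (\<lambda>_. 1))"
  note d = deflection_Beam_double_primitive[OF one, folded e_def]
  have val: "deflection e t = t\<^sup>2 / 2" if "t \<in> {0..1}" for t
  proof -
    have "integral {0..t} (\<lambda>s. integral {0..s} (\<lambda>_. 1::real)) = integral {0..t} (\<lambda>s. s)"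
      by (rule integral_cong) auto
    also have "((\<lambda>s. s) has_integral (t\<^sup>2 / 2 - 0\<^sup>2 / 2)) {0..t}"
      using that by (intro fundamental_theorem_of_calculus)
        (auto simp: has_real_derivative_iff_has_vector_derivative[symmetric] intro!: derivative_eq_intros)
    then have "integral {0..t} (\<lambda>s. s) = t\<^sup>2 / 2" by (simp add: integral_unique)
    finally show ?thesis using that by (simp add: d double_primitive_def)
  qed
  have "(norm e)\<^sup>2 = X_inner (double_primitive (\<lambda>_. 1)) (double_primitive (\<lambda>_. 1))"
    unfolding power2_norm_eq_inner inner_beam.rep_eq d ..
  also have "\<dots> = 1"
    unfolding X_inner_double_primitive[OF one one] mult_1 by (rule integral_mu_const)
  finally have ne: "norm e = 1" by (simp add: power2_eq_1_iff) (smt (verit) norm_ge_zero)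
  have "convex_on {0..1} (deflection e)"
  proof (rule convex_on_of_mono_deriv)
    show "(deflection e has_real_derivative integral {0..t} (\<lambda>_. 1)) (at t within {0..1})" if "t \<in> {0..1}" for t
      unfolding d by (rule double_primitive_deriv[OF integrable_mu_const that])
    show "mono_on {0..1} (\<lambda>t::real. integral {0..t} (\<lambda>_. 1::real))"
      by (rule mono_onI) simp
  qed
  moreover have "M0 t * norm e \<le> deflection e t" if t: "t \<in> {0..1}" for t
    using M0_bounds(2)[OF t] val[OF t] zero_le_power2[of t] unfolding ne mult_1_right by linarith
  ultimately have "e \<in> beam_cone" by (simp add: cone_iff)
  then show thesis using ne by (rule that)
qed

lemma deflection_range:
  "\<lbrakk>u \<in> beam_cone; norm u \<le> R; t \<in> {0..1}\<rbrakk> \<Longrightarrow> deflection u t \<in> {0..R}"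
  using deflection_nonneg[of u t] deflection_le_norm[of t u] by auto

section \<open>The fixed point operator and the energy\<close>

locale monotone_load =
  fixes f :: "real \<Rightarrow> real"
  assumes cont_f: "continuous_on {0..} f" and mono_f: "mono_on {0..} f"
    and f_nonneg: "\<And>x. x \<ge> 0 \<Longrightarrow> 0 \<le> f x"
begin

text \<open>The operator \<open>N\<close> of the overview.\<close>

definition solver :: "beam \<Rightarrow> beam" where
  "solver u = load (\<lambda>t. f (deflection u t))"

definition potential :: "beam \<Rightarrow> real" where
  "potential u = integral {0..1} (\<lambda>t. primitive f (deflection u t))"

lemma continuous_load: "u \<in> beam_cone \<Longrightarrow> continuous_on {0..1} (\<lambda>t. f (deflection u t))"
  by (rule continuous_on_compose2[OF cont_f continuous_deflection]) (auto intro: deflection_nonneg)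

lemma f_mono: "0 \<le> x \<Longrightarrow> x \<le> y \<Longrightarrow> f x \<le> f y"
  using mono_f by (auto intro: mono_onD)

lemma f_integrable: "0 \<le> x \<Longrightarrow> f integrable_on {x..y}"
  by (intro integrable_continuous_real continuous_on_subset[OF cont_f]) auto

lemma primitive_eq: "0 \<le> x \<Longrightarrow> primitive f x = integral {0..x} f"
  unfolding primitive_def
  by (intro lebesgue_integral_eq_integral continuous_imp_integrable_real continuous_on_subset[OF cont_f]) auto

text \<open>The tangent inequality of a convex function; the two cases only reflect the orientation
  of the interval between \<open>x\<close> and \<open>y\<close>.\<close>

lemma primitive_convex:
  assumes "0 \<le> x" "0 \<le> y"
  shows "f x * (y - x) \<le> primitive f y - primitive f x"
proof (cases "x \<le> y")
  case True
  have "integral {0..x} f + integral {x..y} f = integral {0..y} f"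
    using assms True f_integrable by (intro Henstock_Kurzweil_Integration.integral_combine) auto
  moreover have "integral {x..y} (\<lambda>_. f x) \<le> integral {x..y} f"
    using assms True f_integrable f_mono by (intro integral_le) (auto intro: integrable_continuous_real)
  ultimately show ?thesis using assms True by (simp add: primitive_eq mult.commute)
next
  case False
  have "integral {0..y} f + integral {y..x} f = integral {0..x} f"
    using assms False f_integrable by (intro Henstock_Kurzweil_Integration.integral_combine) auto
  moreover have "integral {y..x} f \<le> integral {y..x} (\<lambda>_. f x)"
    using assms False f_integrable f_mono by (intro integral_le) (auto intro: integrable_continuous_real)
  ultimately show ?thesis using assms False by (simp add: primitive_eq algebra_simps)
qed

lemma continuous_primitive: "continuous_on {0..B} (primitive f)"
proof -
  have "continuous_on {0..B} (\<lambda>x. integral {0..x} f)"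
    by (intro indefinite_integral_continuous_1 f_integrable) simp
  then show ?thesis by (rule continuous_on_eq) (simp add: primitive_eq)
qed

lemma continuous_potential_density:
  assumes "u \<in> beam_cone" shows "continuous_on {0..1} (\<lambda>t. primitive f (deflection u t))"
proof (rule continuous_on_compose2[OF continuous_primitive[of "norm u"] continuous_deflection])
  show "deflection u ` {0..1} \<subseteq> {0..norm u}"
    using deflection_range[OF assms order_refl] by blast
qed

lemma energy_eq:
  assumes "u \<in> beam_cone" shows "energy f (deflection u) = (norm u)\<^sup>2 / 2 - potential u"
proof -
  have "(LINT t|lebesgue_on {0..1}. primitive f (deflection u t)) = potential u"
    unfolding potential_def
    by (intro lebesgue_integral_eq_integral continuous_imp_integrable_real continuous_potential_density assms) simp
  then show ?thesis by (simp add: energy_def norm_beam.rep_eq)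
qed

text \<open>\<open>solver u\<close> is a subgradient of the potential at \<open>u\<close>: the
  tangent inequality is integrated and \<open>inner_load\<close> recognizes the linear term.\<close>

lemma potential_convex:
  assumes u: "u \<in> beam_cone" and v: "v \<in> beam_cone"
  shows "inner (solver u) (v - u) \<le> potential v - potential u"
proof -
  have i: "(\<lambda>t. primitive f (deflection w t)) integrable_on {0..1}" if "w \<in> beam_cone" for w
    by (intro integrable_continuous_real continuous_potential_density that)
  have "inner (solver u) (v - u) = integral {0..1} (\<lambda>t. f (deflection u t) * deflection (v - u) t)"
    unfolding solver_def by (rule inner_load[OF continuous_load[OF u]])
  also have "\<dots> \<le> integral {0..1} (\<lambda>t. primitive f (deflection v t) - primitive f (deflection u t))"
  proof (rule integral_le)
    show "(\<lambda>t. f (deflection u t) * deflection (v - u) t) integrable_on {0..1}"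
      by (intro integrable_continuous_real continuous_intros continuous_load u continuous_deflection)
    show "f (deflection u t) * deflection (v - u) t \<le> primitive f (deflection v t) - primitive f (deflection u t)"
      if "t \<in> {0..1}" for t
      using primitive_convex[OF deflection_nonneg[OF u that] deflection_nonneg[OF v that]]
      by (simp add: minus_beam.rep_eq)
  qed (intro integrable_diff i u v)
  also have "\<dots> = potential v - potential u"
    unfolding potential_def by (intro Henstock_Kurzweil_Integration.integral_diff i u v)
  finally show ?thesis .
qed

text \<open>With \<open>v = solver u - u\<close>, expanding the square and using the subgradient
  inequality bounds the change of energy by \<open>- s |v|^2 + s^2/2 |v|^2\<close>, which is at most
  \<open>- s/2 |v|^2\<close> for \<open>s\<close> in [0,1].\<close>

lemma energy_descent:
  assumes u: "u \<in> beam_cone" and w: "solver u \<in> beam_cone" and s: "0 \<le> s" "s \<le> 1"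
  shows "energy f (deflection (u + s *\<^sub>R (solver u - u))) \<le>
    energy f (deflection u) - s / 2 * (norm (solver u - u))\<^sup>2"
proof -
  let ?v = "solver u - u"
  note us = cone_segment[OF u w s]
  have "s * inner (solver u) ?v \<le> potential (u + s *\<^sub>R ?v) - potential u"
    using potential_convex[OF u us] by simp
  moreover have "(norm (u + s *\<^sub>R ?v))\<^sup>2 = (norm u)\<^sup>2 + 2 * s * inner u ?v + s\<^sup>2 * (norm ?v)\<^sup>2"
    using dot_norm[of u "s *\<^sub>R ?v"] by (simp add: power_mult_distrib)
  moreover have "inner (solver u) ?v = inner u ?v + (norm ?v)\<^sup>2"
    by (simp add: power2_norm_eq_inner flip: inner_add_left)
  then have "s * inner (solver u) ?v = s * inner u ?v + s * (norm ?v)\<^sup>2"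
    by (simp add: distrib_left)
  moreover have "s\<^sup>2 * (norm ?v)\<^sup>2 \<le> s * (norm ?v)\<^sup>2"
    using s by (intro mult_right_mono) (auto simp: power2_eq_square mult_left_le)
  ultimately show ?thesis unfolding energy_eq[OF u] energy_eq[OF us] by (simp add: field_simps)
qed

lemma solver_in_cone:
  assumes u: "u \<in> beam_cone" shows "solver u \<in> beam_cone"
proof -
  have "mono_on {0..1} (\<lambda>t. f (deflection u t))"
    by (rule mono_onI) (use deflection_nonneg[OF u] mono_onD[OF deflection_mono[OF u]] f_mono in auto)
  then show ?thesis
    unfolding solver_def beam_cone_def mem_Collect_eq
    by (intro load_in_cone continuous_load u f_nonneg deflection_nonneg[OF u])
qed

text \<open>Stated for continuous functions and not for beams because the uniform limit delivered by
  Arzela-Ascoli is only known to be continuous. The bound \<open>R\<close> provides a compact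
  interval on which \<open>f\<close> is uniformly continuous.\<close>

lemma load_uniformly_continuous:
  assumes "\<epsilon> > 0"
  obtains d where "d > 0" "\<And>h k. \<lbrakk>continuous_on {0..1} h; continuous_on {0..1} k;
      \<And>t. t \<in> {0..1} \<Longrightarrow> h t \<in> {0..R} \<and> k t \<in> {0..R} \<and> \<bar>h t - k t\<bar> < d\<rbrakk>
    \<Longrightarrow> norm (load (\<lambda>t. f (h t)) - load (\<lambda>t. f (k t))) \<le> \<epsilon>"
proof -
  have "uniformly_continuous_on {0..R} f"
    by (intro compact_uniformly_continuous continuous_on_subset[OF cont_f]) auto
  then obtain d where d: "d > 0" "\<And>x y. \<lbrakk>x \<in> {0..R}; y \<in> {0..R}; dist y x < d\<rbrakk> \<Longrightarrow> dist (f y) (f x) < \<epsilon>"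
    using assms unfolding uniformly_continuous_on_def by blast
  show thesis
  proof (rule that[OF d(1)])
    fix h k :: "real \<Rightarrow> real" assume h: "continuous_on {0..1} h" and k: "continuous_on {0..1} k"
      and b: "\<And>t. t \<in> {0..1} \<Longrightarrow> h t \<in> {0..R} \<and> k t \<in> {0..R} \<and> \<bar>h t - k t\<bar> < d"
    have "continuous_on {0..1} (\<lambda>t. f (h t))" "continuous_on {0..1} (\<lambda>t. f (k t))"
      using b by (auto intro!: continuous_on_compose2[OF cont_f] h k)
    then show "norm (load (\<lambda>t. f (h t)) - load (\<lambda>t. f (k t))) \<le> \<epsilon>"
    proof (rule norm_load_diff_le)
      show "\<bar>f (h t) - f (k t)\<bar> \<le> \<epsilon>" if "t \<in> {0..1}" for t
        using d(2)[of "k t" "h t"] b[OF that] by (auto simp: dist_real_def)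
    qed
  qed
qed

lemma continuous_solver: "continuous_on (beam_cone \<inter> cball 0 R) solver"
  unfolding continuous_on_iff
proof (intro ballI allI impI)
  fix u and \<epsilon> :: real assume u: "u \<in> beam_cone \<inter> cball 0 R" and "\<epsilon> > 0"
  then have "\<epsilon> / 2 > 0" by simp
  then obtain d where d: "d > 0" "\<And>h k. \<lbrakk>continuous_on {0..1} h; continuous_on {0..1} k;
      \<And>t. t \<in> {0..1} \<Longrightarrow> h t \<in> {0..R} \<and> k t \<in> {0..R} \<and> \<bar>h t - k t\<bar> < d\<rbrakk>
    \<Longrightarrow> norm (load (\<lambda>t. f (h t)) - load (\<lambda>t. f (k t))) \<le> \<epsilon> / 2"
    using load_uniformly_continuous[of "\<epsilon> / 2" R] by metis
  show "\<exists>d>0. \<forall>v\<in>beam_cone \<inter> cball 0 R. dist v u < d \<longrightarrow> dist (solver v) (solver u) < \<epsilon>"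
  proof (intro exI[of _ d] conjI ballI impI)
    fix v assume v: "v \<in> beam_cone \<inter> cball 0 R" and "dist v u < d"
    have "norm (solver v - solver u) \<le> \<epsilon> / 2"
      unfolding solver_def
    proof (rule d(2)[OF continuous_deflection continuous_deflection], intro conjI)
      fix t :: real assume t: "t \<in> {0..1}"
      show "deflection v t \<in> {0..R}" "deflection u t \<in> {0..R}"
        using u v t by (auto intro!: deflection_range simp del: atLeastAtMost_iff)
      show "\<bar>deflection v t - deflection u t\<bar> < d"
        using deflection_le_norm[OF t, of "v - u"] \<open>dist v u < d\<close> by (simp add: minus_beam.rep_eq dist_norm)
    qed
    then show "dist (solver v) (solver u) < \<epsilon>" using \<open>\<epsilon> > 0\<close> by (simp add: dist_norm)
  qed (rule d(1))
qed

text \<open>Bounded deflections are equi-Lipschitz, so a subsequence converges uniformly to some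
  \<open>g\<close>, and the images converge in norm to
  \<open>load (\<lambda>t. f (g t))\<close>.\<close>

lemma solver_seq_compact:
  assumes u: "\<And>n. u n \<in> beam_cone \<inter> cball 0 R"
  shows "\<exists>w r. strict_mono (r :: nat \<Rightarrow> nat) \<and> (\<lambda>n. solver (u (r n))) \<longlonglongrightarrow> w"
proof -
  have c: "u n \<in> beam_cone" "norm (u n) \<le> R" for n using u[of n] by auto
  have "R \<ge> 0" using c(2)[of 0] norm_ge_zero order_trans by blast
  obtain g r where g: "continuous_on {0..1} g" "strict_mono (r :: nat \<Rightarrow> nat)"
    and lim: "\<And>e. 0 < e \<Longrightarrow> \<exists>N. \<forall>n t. n \<ge> N \<and> t \<in> {0..1} \<longrightarrow> norm (deflection (u (r n)) t - g t) < e"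
  proof (rule Arzela_Ascoli[of "{0..1::real}" "\<lambda>n. deflection (u n)" R])
    show "norm (deflection (u n) t) \<le> R" if "t \<in> {0..1}" for n t
      using deflection_le_norm[OF that, of "u n"] c(2)[of n] by simp
    fix x e :: real assume x: "x \<in> {0..1}" and e: "0 < e"
    show "\<exists>d>0. \<forall>n y. y \<in> {0..1} \<and> norm (x - y) < d \<longrightarrow> norm (deflection (u n) x - deflection (u n) y) < e"
    \<comment> \<open>\<open>R + 1\<close> in place of the Lipschitz constant \<open>R\<close> keeps
      the quotient meaningful when \<open>R = 0\<close>.\<close>
    proof (intro exI[of _ "e / (R + 1)"] conjI allI impI)
      show "0 < e / (R + 1)" using e \<open>R \<ge> 0\<close> by simp
      fix n y assume y: "y \<in> {0..1} \<and> norm (x - y) < e / (R + 1)"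
      have "\<bar>deflection (u n) x - deflection (u n) y\<bar> \<le> norm (u n) * \<bar>x - y\<bar>"
        using x y by (intro deflection_Lipschitz) auto
      also have "\<dots> \<le> (R + 1) * \<bar>x - y\<bar>" using c(2)[of n] by (intro mult_right_mono) auto
      also have "\<dots> < e" using y \<open>R \<ge> 0\<close> by (simp add: pos_less_divide_eq mult.commute)
      finally show "norm (deflection (u n) x - deflection (u n) y) < e" by simp
    qed
  qed auto
  have pointwise: "(\<lambda>n. deflection (u (r n)) t) \<longlonglongrightarrow> g t" if "t \<in> {0..1}" for t
    using lim that unfolding LIMSEQ_iff by meson
  have gR: "g t \<in> {0..R}" if "t \<in> {0..1}" for t
    using closed_sequentially[OF closed_atLeastAtMost _ pointwise[OF that], of 0 R]
      deflection_range[OF c that] by blast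
  have "(\<lambda>n. solver (u (r n))) \<longlonglongrightarrow> load (\<lambda>t. f (g t))"
    unfolding LIMSEQ_iff
  proof (intro allI impI)
    fix \<epsilon> :: real assume "\<epsilon> > 0"
    then have "\<epsilon> / 2 > 0" by simp
    then obtain d where d: "d > 0" "\<And>h k. \<lbrakk>continuous_on {0..1} h; continuous_on {0..1} k;
        \<And>t. t \<in> {0..1} \<Longrightarrow> h t \<in> {0..R} \<and> k t \<in> {0..R} \<and> \<bar>h t - k t\<bar> < d\<rbrakk>
      \<Longrightarrow> norm (load (\<lambda>t. f (h t)) - load (\<lambda>t. f (k t))) \<le> \<epsilon> / 2"
      using load_uniformly_continuous[of "\<epsilon> / 2" R] by metis
    obtain N where N: "\<And>n t. n \<ge> N \<Longrightarrow> t \<in> {0..1} \<Longrightarrow> \<bar>deflection (u (r n)) t - g t\<bar> < d"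
      using lim[OF d(1)] by auto
    have "norm (solver (u (r n)) - load (\<lambda>t. f (g t))) < \<epsilon>" if "n \<ge> N" for n
    proof -
      have "norm (solver (u (r n)) - load (\<lambda>t. f (g t))) \<le> \<epsilon> / 2"
        unfolding solver_def
        by (rule d(2)[OF continuous_deflection g(1)]) (use N that gR deflection_range[OF c] in blast)
      then show ?thesis using \<open>\<epsilon> > 0\<close> by simp
    qed
    then show "\<exists>N. \<forall>n\<ge>N. norm (solver (u (r n)) - load (\<lambda>t. f (g t))) < \<epsilon>" by blast
  qed
  then show ?thesis using g(2) by blast
qed

lemma load_zero: "load (\<lambda>_. 0) = 0"
  using inner_load[of "\<lambda>_. 0" "load (\<lambda>_. 0)"] by simp

lemma norm_solver_le: "u \<in> beam_cone \<Longrightarrow> norm u \<le> R \<Longrightarrow> norm (solver u) \<le> f R"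
  using norm_load_diff_le[of "\<lambda>t. f (deflection u t)" "\<lambda>_. 0" "f R"] deflection_range[of u R]
  by (auto simp: load_zero solver_def continuous_load f_mono f_nonneg)

text \<open>The subgradient inequality at \<open>v\<close> bounds the increase from \<open>u\<close>
  to \<open>v\<close>. Exchanging the two arguments yields Lipschitz continuity of the potential on
  bounded parts of the cone.\<close>

lemma potential_le:
  assumes "u \<in> beam_cone" "v \<in> beam_cone" "norm v \<le> R"
  shows "potential v - potential u \<le> f R * norm (v - u)"
proof -
  have "potential v - potential u \<le> inner (solver v) (v - u)"
    using potential_convex[OF assms(2,1)] by (simp add: inner_diff_right)
  also have "\<dots> \<le> norm (solver v) * norm (v - u)" by (rule norm_cauchy_schwarz)
  also have "\<dots> \<le> f R * norm (v - u)" by (intro mult_right_mono norm_solver_le assms) simp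
  finally show ?thesis .
qed

lemma continuous_energy: "continuous_on (beam_cone \<inter> cball 0 R) (\<lambda>u. energy f (deflection u))"
proof -
  \<comment> \<open>For negative \<open>R\<close> the set is empty and nothing is known about the
    sign of \<open>f R\<close>; the maximum keeps the Lipschitz constant nonnegative.\<close>
  have "(max 0 (f R))-lipschitz_on (beam_cone \<inter> cball 0 R) potential"
  proof (rule lipschitz_onI)
    fix u v assume uv: "u \<in> beam_cone \<inter> cball 0 R" "v \<in> beam_cone \<inter> cball 0 R"
    have "\<bar>potential u - potential v\<bar> \<le> f R * norm (u - v)"
      using potential_le[of u v R] potential_le[of v u R] uv by (auto simp: norm_minus_commute)
    also have "\<dots> \<le> max 0 (f R) * norm (u - v)" by (intro mult_right_mono) auto
    finally show "dist (potential u) (potential v) \<le> max 0 (f R) * dist u v"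
      by (simp add: dist_norm)
  qed simp
  then have "continuous_on (beam_cone \<inter> cball 0 R) potential" by (rule lipschitz_on_continuous_on)
  then have "continuous_on (beam_cone \<inter> cball 0 R) (\<lambda>u. (norm u)\<^sup>2 / 2 - potential u)"
    by (intro continuous_intros) auto
  then show ?thesis by (rule continuous_on_eq) (simp add: energy_eq)
qed

lemma energy_bounded_below:
  assumes "u \<in> beam_cone" "norm u \<le> R" shows "- (potential 0 + f R * R) \<le> energy f (deflection u)"
proof -
  have "0 \<in> beam_cone" using cone_scaleR[OF assms(1), of 0] by simp
  then have "potential u - potential 0 \<le> f R * norm u"
    using potential_le[of 0 u R] assms by simp
  also have "\<dots> \<le> f R * R"
    using assms f_nonneg[of R] norm_ge_zero[of u] by (intro mult_left_mono) auto
  finally show ?thesis unfolding energy_eq[OF assms(1)] using zero_le_power2[of "norm u"] by linarith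
qed

lemma fixpoint_is_solution:
  assumes "u \<in> beam_cone" "solver u = u" shows "is_solution f (deflection u)"
proof -
  have "is_solution f (deflection (load (\<lambda>t. f (deflection u t))))"
    by (rule load_is_solution[OF continuous_load[OF assms(1)]]) (use assms(2) in \<open>simp add: solver_def\<close>)
  then show ?thesis using assms(2) by (simp add: solver_def)
qed

end

section \<open>The conical shell\<close>

definition beam_shell :: "real \<Rightarrow> real \<Rightarrow> beam set" where
  "beam_shell R0 R1 = {u \<in> beam_cone. R0 \<le> norm u \<and> norm u \<le> R1}"

lemma shell_eq_image: "shell R0 R1 = deflection ` beam_shell R0 R1"
proof
  show "shell R0 R1 \<subseteq> deflection ` beam_shell R0 R1"
  proof
    fix u assume u: "u \<in> shell R0 R1"
    then have "deflection (Beam u) = u" by (intro Beam_inverse) (simp add: shell_def K_cone_def)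
    then show "u \<in> deflection ` beam_shell R0 R1"
      using u by (intro image_eqI[of _ _ "Beam u"])
        (auto simp: shell_def beam_shell_def beam_cone_def norm_beam.rep_eq)
  qed
qed (auto simp: shell_def beam_shell_def beam_cone_def norm_beam.rep_eq)

lemma beam_shell_subset: "beam_shell R0 R1 \<subseteq> beam_cone \<inter> cball 0 R1"
  by (auto simp: beam_shell_def)

lemma closed_beam_shell: "closed (beam_shell R0 R1)"
proof -
  have "beam_shell R0 R1 = beam_cone \<inter> {u. R0 \<le> norm u} \<inter> {u. norm u \<le> R1}"
    by (auto simp: beam_shell_def)
  then show ?thesis
    by (simp add: closed_Int closed_cone closed_Collect_le continuous_on_const continuous_on_norm_id)
qed

lemma deflection_shell_iff: "deflection u \<in> shell R0 R1 \<longleftrightarrow> u \<in> beam_shell R0 R1"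
  by (auto simp: shell_eq_image deflection_inject)

lemma continuous_path_iff:
  assumes \<gamma>: "\<And>t. t \<in> {0..1} \<Longrightarrow> \<gamma> t = deflection (\<delta> t)"
  shows "(\<forall>t\<in>{0..1}. ((\<lambda>s. X_norm (\<lambda>x. \<gamma> s x - \<gamma> t x)) \<longlongrightarrow> 0) (at t within {0..1})) \<longleftrightarrow>
    continuous_on {0..1} \<delta>"
proof -
  have "((\<lambda>s. X_norm (\<lambda>x. \<gamma> s x - \<gamma> t x)) \<longlongrightarrow> 0) (at t within {0..1}) \<longleftrightarrow>
      (\<delta> \<longlongrightarrow> \<delta> t) (at t within {0..1})" if t: "t \<in> {0..1}" for t
    unfolding tendsto_dist_iff[of \<delta>]
  proof (rule tendsto_cong)
    have "\<forall>\<^sub>F s in at t within {0..1}. s \<in> {0..1}"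
      by (auto simp: eventually_at_filter)
    then show "\<forall>\<^sub>F s in at t within {0..1}. X_norm (\<lambda>x. \<gamma> s x - \<gamma> t x) = dist (\<delta> s) (\<delta> t)"
      by eventually_elim (simp add: dist_norm norm_beam.rep_eq minus_beam.rep_eq \<gamma> \<gamma>[OF t])
  qed
  then show ?thesis by (auto simp: continuous_on_def)
qed

text \<open>Paths are unconstrained off [0,1], so a path of functions need not come from beams at
  every time; what is shown to coincide is the set of path suprema.\<close>

lemma minimax_level_eq:
  "minimax_level f R0 R1 (deflection u0) (deflection u1) =
    (INF \<gamma>\<in>paths_in (beam_shell R0 R1) u0 u1. SUP t\<in>{0..1}. energy f (deflection (\<gamma> t)))"
proof -
  have "(\<lambda>\<gamma>. SUP t\<in>{0..1}. energy f (\<gamma> t)) ` shell_paths R0 R1 (deflection u0) (deflection u1) =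
      (\<lambda>\<gamma>. SUP t\<in>{0..1}. energy f (deflection (\<gamma> t))) ` paths_in (beam_shell R0 R1) u0 u1" (is "?l ` _ = ?r ` _")
  proof (intro equalityI image_subsetI)
    fix \<gamma> assume \<gamma>: "\<gamma> \<in> shell_paths R0 R1 (deflection u0) (deflection u1)"
    define \<delta> where "\<delta> t = Beam (\<gamma> t)" for t
    have sh: "\<gamma> t \<in> shell R0 R1" if "t \<in> {0..1}" for t using \<gamma> that by (simp add: shell_paths_def)
    then have d: "\<gamma> t = deflection (\<delta> t)" if "t \<in> {0..1}" for t
      unfolding \<delta>_def using that by (intro Beam_inverse[symmetric]) (auto simp: shell_def K_cone_def)
    have "\<delta> t \<in> beam_shell R0 R1" if "t \<in> {0..1}" for t
      using sh[OF that] d[OF that] by (simp add: deflection_shell_iff)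
    moreover have "continuous_on {0..1} \<delta>"
      using \<gamma> by (intro iffD1[OF continuous_path_iff[of \<gamma> \<delta>, OF d]]) (auto simp: shell_paths_def)
    ultimately have "\<delta> \<in> paths_in (beam_shell R0 R1) u0 u1"
      using \<gamma> by (auto simp: paths_in_def shell_paths_def \<delta>_def deflection_inverse)
    moreover have "?l \<gamma> = ?r \<delta>" using d by (intro SUP_cong) auto
    ultimately show "?l \<gamma> \<in> ?r ` paths_in (beam_shell R0 R1) u0 u1" by blast
  next
    fix \<delta> assume \<delta>: "\<delta> \<in> paths_in (beam_shell R0 R1) u0 u1"
    then have "(\<lambda>t. deflection (\<delta> t)) \<in> shell_paths R0 R1 (deflection u0) (deflection u1)"
      using continuous_path_iff[of "\<lambda>t. deflection (\<delta> t)" \<delta>]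
      by (auto simp: paths_in_def shell_paths_def deflection_shell_iff)
    then show "?r \<delta> \<in> ?l ` shell_paths R0 R1 (deflection u0) (deflection u1)"
      by (rule rev_image_eqI) simp
  qed
  then show ?thesis by (simp add: minimax_level_def)
qed

text \<open>The straight segment \<open>p\<close> stays in the cone, but its norm may fall below
  \<open>R0\<close>, so it is rescaled to the interpolated norm \<open>r\<close>. It never vanishes:
  the cone bound at 1/2 passes to combinations and gives
  \<open>norm (p t) >= M0 (1/2) * r t > 0\<close>.\<close>

lemma paths_in_shell_nonempty:
  assumes u0: "u0 \<in> beam_shell R0 R1" and u1: "u1 \<in> beam_shell R0 R1" and "0 < R0"
  shows "paths_in (beam_shell R0 R1) u0 u1 \<noteq> {}"
proof -
  define p where "p t = (1 - t) *\<^sub>R u0 + t *\<^sub>R u1" for t :: real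
  define r where "r t = (1 - t) * norm u0 + t * norm u1" for t :: real
  have K: "u0 \<in> beam_cone" "u1 \<in> beam_cone" "R0 \<le> norm u0" "R0 \<le> norm u1" "norm u0 \<le> R1" "norm u1 \<le> R1"
    using u0 u1 by (auto simp: beam_shell_def)
  have r: "R0 \<le> r t" "r t \<le> R1" if "t \<in> {0..1}" for t
    unfolding r_def using that K convex_bound_le[of "norm u0" R1 "norm u1" "1 - t" t]
      convex_bound_le[of "- norm u0" "- R0" "- norm u1" "1 - t" t] by auto
  have p: "p t \<in> beam_cone" if "t \<in> {0..1}" for t
    unfolding p_def using that K by (intro cone_add cone_scaleR) auto
  have p0: "0 < norm (p t)" if t: "t \<in> {0..1}" for t
  proof -
    have M: "M0 (1 / 2) > 0" by (simp add: M0_def)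
    have "M0 (1 / 2) * r t = (1 - t) * (M0 (1 / 2) * norm u0) + t * (M0 (1 / 2) * norm u1)"
      by (simp add: r_def algebra_simps)
    also have "\<dots> \<le> (1 - t) * deflection u0 (1 / 2) + t * deflection u1 (1 / 2)"
      using K t by (intro add_mono mult_left_mono) (auto simp: cone_iff)
    also have "\<dots> = deflection (p t) (1 / 2)"
      by (simp add: p_def plus_beam.rep_eq scaleR_beam.rep_eq)
    also have "\<dots> \<le> norm (p t)" using deflection_le_norm[of "1 / 2" "p t"] by simp
    finally have "M0 (1 / 2) * r t \<le> norm (p t)" .
    moreover have "0 < M0 (1 / 2) * r t" using M r[OF t] \<open>0 < R0\<close> by simp
    ultimately show ?thesis by linarith
  qed
  have "(\<lambda>t. (r t / norm (p t)) *\<^sub>R p t) \<in> paths_in (beam_shell R0 R1) u0 u1"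
    unfolding paths_in_def
  proof (intro CollectI conjI image_subsetI)
    have "continuous_on {0..1} p" "continuous_on {0..1} r"
      unfolding p_def r_def by (intro continuous_intros)+
    then show "continuous_on {0..1} (\<lambda>t. (r t / norm (p t)) *\<^sub>R p t)"
      using p0 by (intro continuous_intros) auto
    fix t :: real assume t: "t \<in> {0..1}"
    have "norm ((r t / norm (p t)) *\<^sub>R p t) = r t"
      using p0[OF t] r[OF t] \<open>0 < R0\<close> by simp
    moreover have "(r t / norm (p t)) *\<^sub>R p t \<in> beam_cone"
      using p0[OF t] r[OF t] \<open>0 < R0\<close> by (intro cone_scaleR p t) auto
    ultimately show "(r t / norm (p t)) *\<^sub>R p t \<in> beam_shell R0 R1"
      using r[OF t] by (simp add: beam_shell_def)
  qed (use p0[of 0] p0[of 1] in \<open>auto simp: r_def p_def\<close>)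
  then show ?thesis by blast
qed

section \<open>Invariance of the shell and the variational levels\<close>

locale shell_problem = monotone_load f for f :: "real \<Rightarrow> real" +
  fixes a R0 R1 :: real
  assumes a: "0 < a" "a < 1" and R: "0 < R0" "R0 < R1"
    and lower: "1 / ((1 - a) * (M0 a)\<^sup>2) \<le> f (M0 a * R0) / (M0 a * R0)"
    and upper: "f (2 / 3 * R1) / R1 \<le> 15 / 4"
begin

lemma M0_pos: "0 < M0 a" using a by (simp add: M0_def)

lemma f_upper: "f (2 / 3 * R1) \<le> 15 / 4 * R1"
  using upper R by (simp add: pos_divide_le_eq)

lemma f_lower: "R0 \<le> (1 - a) * f (M0 a * R0) * M0 a"
proof -
  have "1 / ((1 - a) * (M0 a)\<^sup>2) * ((1 - a) * (M0 a)\<^sup>2 * R0) \<le>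
      f (M0 a * R0) / (M0 a * R0) * ((1 - a) * (M0 a)\<^sup>2 * R0)"
    using a R by (intro mult_right_mono lower) auto
  then show ?thesis using a R M0_pos by (simp add: power2_eq_square mult_ac)
qed

text \<open>With \<open>v = solver u\<close>, the square \<open>|v|^2\<close> is the integral of
  \<open>f(u) v\<close>, at most \<open>15/4 R1\<close> times the integral of \<open>v\<close>,
  which is at most \<open>4/15 |v|\<close>; the constants cancel exactly.\<close>

lemma norm_solver_upper:
  assumes u: "u \<in> beam_shell R0 R1" shows "norm (solver u) \<le> R1"
proof -
  let ?v = "solver u"
  have uc: "u \<in> beam_cone" "norm u \<le> R1" using u by (auto simp: beam_shell_def)
  note vc = solver_in_cone[OF uc(1)]
  have "norm ?v * norm ?v = inner ?v ?v" by (simp add: power2_norm_eq_inner flip: power2_eq_square)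
  also have "\<dots> = integral {0..1} (\<lambda>t. f (deflection u t) * deflection ?v t)"
    by (subst (1) solver_def) (rule inner_load[OF continuous_load[OF uc(1)]])
  also have "\<dots> \<le> integral {0..1} (\<lambda>t. 15 / 4 * R1 * deflection ?v t)"
  proof (rule integral_le)
    show "(\<lambda>t. f (deflection u t) * deflection ?v t) integrable_on {0..1}"
      "(\<lambda>t. 15 / 4 * R1 * deflection ?v t) integrable_on {0..1}"
      by (intro integrable_continuous_real continuous_intros continuous_load uc continuous_deflection)+
    fix t :: real assume t: "t \<in> {0..1}"
    have "f (deflection u t) \<le> f (2 / 3 * R1)"
      using deflection_le[OF t, of u] uc(2) by (intro f_mono deflection_nonneg[OF uc(1) t]) auto
    then show "f (deflection u t) * deflection ?v t \<le> 15 / 4 * R1 * deflection ?v t"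
      using f_upper by (intro mult_right_mono deflection_nonneg[OF vc t]) auto
  qed
  also have "\<dots> = 15 / 4 * R1 * integral {0..1} (deflection ?v)" by simp
  also have "\<dots> \<le> 15 / 4 * R1 * (4 / 15 * norm ?v)"
    using R by (intro mult_left_mono integral_deflection_le) auto
  finally have "norm ?v * norm ?v \<le> R1 * norm ?v" by simp
  then show ?thesis using R by (cases "norm ?v = 0") (auto simp: mult_le_cancel_right)
qed

text \<open>Only the part over [a,1] is kept. There monotonicity of \<open>u\<close> gives
  \<open>u >= u(a) >= M0(a) |u|\<close>, one factor bounding \<open>u\<close> itself and, through
  \<open>|u| >= R0\<close>, the other bounding \<open>f(u)\<close>. The length \<open>1 - a\<close>
  of the interval completes the constant.\<close>

lemma inner_solver_lower:
  assumes u: "u \<in> beam_shell R0 R1" shows "R0 * norm u \<le> inner (solver u) u"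
proof -
  have uc: "u \<in> beam_cone" "R0 \<le> norm u" using u by (auto simp: beam_shell_def)
  let ?q = "\<lambda>t. f (deflection u t) * deflection u t"
  have cq: "continuous_on {0..1} ?q"
    by (intro continuous_intros continuous_load uc continuous_deflection)
  have ua: "M0 a * norm u \<le> deflection u a" using uc a by (simp add: cone_iff)
  have Ma: "M0 a * R0 \<le> M0 a * norm u" using M0_pos uc by simp
  have fa: "0 \<le> f (M0 a * R0)" using M0_pos R by (intro f_nonneg) simp
  have "R0 * norm u \<le> (1 - a) * f (M0 a * R0) * M0 a * norm u"
    by (intro mult_right_mono f_lower) simp
  also have "\<dots> = integral {a..1} (\<lambda>_. f (M0 a * R0) * (M0 a * norm u))"
    using a by simp
  also have "\<dots> \<le> integral {a..1} ?q"
  proof (rule integral_le)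
    show "?q integrable_on {a..1}"
      using a by (intro integrable_continuous_real continuous_on_subset[OF cq]) auto
    fix t assume "t \<in> {a..1}"
    then have "deflection u a \<le> deflection u t"
      using a by (intro mono_onD[OF deflection_mono[OF uc(1)]]) auto
    then have "M0 a * norm u \<le> deflection u t" "M0 a * R0 \<le> deflection u t" using ua Ma by auto
    moreover from this have "f (M0 a * R0) \<le> f (deflection u t)"
      using M0_pos R by (intro f_mono) auto
    ultimately show "f (M0 a * R0) * (M0 a * norm u) \<le> ?q t"
      using M0_pos fa by (intro mult_mono) auto
  qed (rule integrable_continuous_real[OF continuous_on_const])
  also have "\<dots> \<le> integral {0..1} ?q"
    using a by (intro integral_subset_le integrable_continuous_real continuous_on_subset[OF cq])
      (auto intro!: mult_nonneg_nonneg f_nonneg deflection_nonneg[OF uc(1)])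
  also have "\<dots> = inner (solver u) u"
    unfolding solver_def by (rule inner_load[OF continuous_load[OF uc(1)], symmetric])
  finally show ?thesis .
qed

text \<open>The cone and the outer ball are convex. The inner radius is not preserved by convexity,
  so it is recovered from the component of the segment along \<open>u\<close>.\<close>

lemma shell_segment:
  assumes u: "u \<in> beam_shell R0 R1" and s: "0 \<le> s" "s \<le> 1"
  shows "u + s *\<^sub>R (solver u - u) \<in> beam_shell R0 R1"
proof -
  have uc: "u \<in> beam_cone" "R0 \<le> norm u" "norm u \<le> R1" using u by (auto simp: beam_shell_def)
  let ?w = "u + s *\<^sub>R (solver u - u)"
  have w: "?w = (1 - s) *\<^sub>R u + s *\<^sub>R solver u" by (simp add: algebra_simps)
  have "norm ?w \<le> (1 - s) * norm u + s * norm (solver u)"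
    unfolding w using s by (intro norm_triangle_le) simp
  also have "\<dots> \<le> R1"
    using s uc norm_solver_upper[OF u] by (intro convex_bound_le) auto
  finally have "norm ?w \<le> R1" .
  moreover have "R0 * norm u \<le> norm ?w * norm u"
  proof -
    have "R0 * norm u = (1 - s) * (R0 * norm u) + s * (R0 * norm u)" by (simp add: algebra_simps)
    also have "\<dots> \<le> (1 - s) * (norm u * norm u) + s * inner (solver u) u"
      using s uc inner_solver_lower[OF u] by (intro add_mono mult_left_mono mult_right_mono) auto
    also have "\<dots> = inner ?w u"
      unfolding w by (simp add: inner_add_left power2_norm_eq_inner flip: power2_eq_square)
    also have "\<dots> \<le> norm ?w * norm u" by (rule norm_cauchy_schwarz)
    finally show ?thesis .
  qed
  then have "R0 \<le> norm ?w" using uc R by (auto simp: mult_le_cancel_right)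
  moreover have "?w \<in> beam_cone" by (intro cone_segment solver_in_cone uc s)
  ultimately show ?thesis by (simp add: beam_shell_def)
qed

sublocale descent_map "beam_shell R0 R1" "\<lambda>u. energy f (deflection u)" solver
proof
  show "closed (beam_shell R0 R1)" by (rule closed_beam_shell)
  show "continuous_on (beam_shell R0 R1) (\<lambda>u. energy f (deflection u))"
    by (rule continuous_on_subset[OF continuous_energy beam_shell_subset])
  show "continuous_on (beam_shell R0 R1) solver"
    by (rule continuous_on_subset[OF continuous_solver beam_shell_subset])
  show "u + s *\<^sub>R (solver u - u) \<in> beam_shell R0 R1" if "u \<in> beam_shell R0 R1" "0 \<le> s" "s \<le> 1" for u s
    using that by (rule shell_segment)
  show "energy f (deflection (u + s *\<^sub>R (solver u - u))) \<le>
      energy f (deflection u) - s / 2 * (norm (solver u - u))\<^sup>2"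
    if "u \<in> beam_shell R0 R1" "0 \<le> s" "s \<le> 1" for u s
    using that by (intro energy_descent solver_in_cone) (auto simp: beam_shell_def)
  show "\<exists>w r. strict_mono r \<and> (\<lambda>n. solver (x (r n))) \<longlonglongrightarrow> w" if "\<And>n. x n \<in> beam_shell R0 R1"
    for x :: "nat \<Rightarrow> beam"
    by (rule solver_seq_compact[of x R1]) (use that beam_shell_subset in blast)
  show "bdd_below ((\<lambda>u. energy f (deflection u)) ` beam_shell R0 R1)"
  proof (rule bdd_belowI2)
    show "- (potential 0 + f R1 * R1) \<le> energy f (deflection u)" if "u \<in> beam_shell R0 R1" for u
      using that by (intro energy_bounded_below) (auto simp: beam_shell_def)
  qed
qed

lemma beam_shell_nonempty: "beam_shell R0 R1 \<noteq> {}"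
proof -
  obtain e where "e \<in> beam_cone" "norm e = 1" by (rule cone_unit_element)
  then have "R0 *\<^sub>R e \<in> beam_shell R0 R1" using R by (simp add: beam_shell_def cone_scaleR)
  then show ?thesis by blast
qed

lemma positive_solution_of_fixpoint:
  assumes u: "u \<in> beam_shell R0 R1" and fp: "solver u = u"
  shows "positive_solution f (deflection u)"
proof -
  have uc: "u \<in> beam_cone" "R0 \<le> norm u" using u by (auto simp: beam_shell_def)
  have "0 < M0 a * norm u" using uc R by (intro mult_pos_pos M0_pos) linarith
  also have "\<dots> \<le> deflection u a" using uc a by (simp add: cone_iff)
  finally have "\<exists>t\<in>{0..1}. deflection u t \<noteq> 0" using a by (intro bexI[of _ a]) auto
  then show ?thesis
    using fixpoint_is_solution[OF uc(1) fp] deflection_nonneg[OF uc(1)] by (auto simp: positive_solution_def)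
qed

text \<open>By the intermediate value theorem each path meets the sphere of radius \<open>r\<close>.
  The part of that sphere in the cone lies in the shell, since \<open>r\<close> is between two
  admissible norms, so the energy is bounded below there.\<close>

lemma minimax_level_ge:
  assumes u0: "u0 \<in> beam_shell R0 R1" and u1: "u1 \<in> beam_shell R0 R1"
    and r: "norm u0 < r" "r < norm u1"
  shows "(INF u\<in>{u \<in> K_cone. X_norm u = r}. energy f u) \<le> minimax_level f R0 R1 (deflection u0) (deflection u1)"
  unfolding minimax_level_eq
proof (rule cINF_greatest)
  show "paths_in (beam_shell R0 R1) u0 u1 \<noteq> {}" by (rule paths_in_shell_nonempty[OF u0 u1 R(1)])
  fix \<gamma> assume \<gamma>: "\<gamma> \<in> paths_in (beam_shell R0 R1) u0 u1"
  then have g: "continuous_on {0..1} \<gamma>" "\<gamma> 0 = u0" "\<gamma> 1 = u1" "\<And>t. t \<in> {0..1} \<Longrightarrow> \<gamma> t \<in> beam_shell R0 R1"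
    by (auto simp: paths_in_def)
  have "\<exists>t\<ge>0. t \<le> 1 \<and> norm (\<gamma> t) = r"
    using r g by (intro IVT') (auto intro!: continuous_intros)
  then obtain t where t: "t \<in> {0..1}" "norm (\<gamma> t) = r" by auto
  have "bdd_below (energy f ` {u \<in> K_cone. X_norm u = r})"
  proof (rule bdd_belowI2)
    fix u assume u: "u \<in> {u \<in> K_cone. X_norm u = r}"
    then have "u \<in> shell R0 R1" using r u0 u1 by (auto simp: shell_def beam_shell_def)
    then show "(INF v\<in>beam_shell R0 R1. energy f (deflection v)) \<le> energy f u"
      unfolding shell_eq_image by (auto intro: cINF_lower[OF bdd_E])
  qed
  then have "(INF u\<in>{u \<in> K_cone. X_norm u = r}. energy f u) \<le> energy f (deflection (\<gamma> t))"
    by (rule cINF_lower) (use g(4)[OF t(1)] t(2) in \<open>auto simp: beam_shell_def beam_cone_def norm_beam.rep_eq\<close>)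
  also have "\<dots> \<le> (SUP t\<in>{0..1}. energy f (deflection (\<gamma> t)))"
    by (rule cSUP_upper[OF t(1) bdd_above_path[OF \<gamma>]])
  finally show "(INF u\<in>{u \<in> K_cone. X_norm u = r}. energy f u) \<le> (SUP t\<in>{0..1}. energy f (deflection (\<gamma> t)))" .
qed

end

theorem theorem3p3:
  fixes f :: "real \<Rightarrow> real" and a R0 R1 :: real
  assumes "continuous_on {0..} f"
    and "mono_on {0..} f"
    and "\<forall>x\<ge>0. f x \<ge> 0"
    and "0 < a" and "a < 1"
    and "0 < R0" and "R0 < R1"
    and "f (M0 a * R0) / (M0 a * R0) \<ge> 1 / ((1 - a) * (M0 a)\<^sup>2)"
    and "f (2/3 * R1) / R1 \<le> 15/4"
  shows "\<exists>um. um \<in> shell R0 R1 \<and> positive_solution f um \<and>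
           energy f um = (INF u\<in>shell R0 R1. energy f u) \<and>
           (\<forall>u0 u1 r. u0 \<in> shell R0 R1 \<and> u1 \<in> shell R0 R1 \<and> 0 < r \<and>
                X_norm u0 < r \<and> r < X_norm u1 \<and>
                max (energy f u0) (energy f u1) < (INF u\<in>{u \<in> K_cone. X_norm u = r}. energy f u)
              \<longrightarrow> (\<exists>uc. uc \<in> shell R0 R1 \<and> positive_solution f uc \<and>
                     energy f uc = minimax_level f R0 R1 u0 u1 \<and> uc \<noteq> um))"
proof -
  interpret shell_problem f a R0 R1 by standard (use assms in auto)
  obtain w where w: "w \<in> beam_shell R0 R1" "solver w = w"
    "energy f (deflection w) = (INF u\<in>beam_shell R0 R1. energy f (deflection u))"
    using minimum_at_fixpoint[OF beam_shell_nonempty] by blast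
  have inf: "(INF u\<in>shell R0 R1. energy f u) = (INF u\<in>beam_shell R0 R1. energy f (deflection u))"
    by (simp add: shell_eq_image image_image)
  show ?thesis
  proof (rule exI[of _ "deflection w"], intro conjI allI impI)
    show "deflection w \<in> shell R0 R1" using w(1) by (simp add: deflection_shell_iff)
    show "positive_solution f (deflection w)" by (rule positive_solution_of_fixpoint[OF w(1,2)])
    show "energy f (deflection w) = (INF u\<in>shell R0 R1. energy f u)" using w(3) inf by simp
    fix u0' u1' r
    assume A: "u0' \<in> shell R0 R1 \<and> u1' \<in> shell R0 R1 \<and> 0 < r \<and>
      X_norm u0' < r \<and> r < X_norm u1' \<and>
      max (energy f u0') (energy f u1') < (INF u\<in>{u \<in> K_cone. X_norm u = r}. energy f u)"
    then obtain u0 u1 where u: "u0 \<in> beam_shell R0 R1" "u1 \<in> beam_shell R0 R1"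
      "u0' = deflection u0" "u1' = deflection u1"
      unfolding shell_eq_image by blast
    define c where "c = minimax_level f R0 R1 u0' u1'"
    have "(INF u\<in>{u \<in> K_cone. X_norm u = r}. energy f u) \<le> c"
      unfolding c_def u(3,4) using A u by (intro minimax_level_ge) (auto simp: norm_beam.rep_eq)
    then have lt: "energy f (deflection u0) < c" "energy f (deflection u1) < c"
      using A u by auto
    have c: "c = (INF \<gamma>\<in>paths_in (beam_shell R0 R1) u0 u1. SUP t\<in>{0..1}. energy f (deflection (\<gamma> t)))"
      unfolding c_def u(3,4) minimax_level_eq ..
    have "paths_in (beam_shell R0 R1) u0 u1 \<noteq> {}" by (rule paths_in_shell_nonempty[OF u(1,2) R(1)])
    then obtain v where v: "v \<in> beam_shell R0 R1" "solver v = v" "energy f (deflection v) = c"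
      unfolding c by (rule mountain_pass[OF _ lt[unfolded c]])
    \<comment> \<open>Separates the two solutions by their levels: the minimum is at most the energy
      of \<open>u0\<close>, which is strictly below \<open>c\<close>.\<close>
    have "energy f (deflection w) \<le> energy f (deflection u0)"
      unfolding w(3) by (rule cINF_lower[OF bdd_E u(1)])
    then have "deflection v \<noteq> deflection w" using lt v(3) by auto
    then show "\<exists>uc. uc \<in> shell R0 R1 \<and> positive_solution f uc \<and>
        energy f uc = minimax_level f R0 R1 u0' u1' \<and> uc \<noteq> deflection w"
      using v positive_solution_of_fixpoint[OF v(1,2)]
      by (intro exI[of _ "deflection v"]) (auto simp: deflection_shell_iff c_def)
  qed
qed

end
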